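(* Let $M$ be an oriented smooth manifold of dimension $n\ge 3$, possibly with boundary, equipped with a conformal class $[g]$ of Riemannian metrics, and let $\beta\in\Omega^{n-1}(M)$ be a closed, nowhere vanishing $(n-1)$-form. Then there exists a metric in $[g]$ with respect to which $\beta$ is force-free if and only if there exists a (possibly different) metric in $[g]$ with respect to which $\beta$ is geodesic.
   Context: All objects are smooth. Two Riemannian metrics $g,h$ on $M$ are conformally equivalent if $h=e^{2u}g$ for some $u\in C^\infty(M)$; $[g]$ denotes the set of all metrics conformally equivalent to $g$. A closed form $\beta\in\Omega^{n-1}(M)$ is called a flux form. Given a Riemannian metric $g$ on $M$ with volume form $\mu$, Hodge star $\star$ and Levi-Civita connection $\nabla$, the vector field $B$ associated to $\beta$ is defined by $\iota_B\mu=\beta$. With respect to $g$: $\beta$ is force-free if $\iota_B d\star\beta=0$; $\beta$ is geodesic if there is a function $\rho\in C^\infty(M)$ with $\nabla_BB=\rho B$. *)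

theory Defs
  imports "HOL-Analysis.Analysis"
begin

section \<open>Smooth maps on open subsets of the closed half-space\<close>

text \<open>
  The index type carries a linear order (any finite type admits one), which fixes the order
  of the coordinates \<open>x\<^sup>1, \<dots>, x\<^sup>n\<close> and hence the standard orientation of the model space.
  The half-space constrains the last coordinate.
\<close>

type_synonym 'n rvec = "(real, 'n) vec"
type_synonym 'n rmat = "((real, 'n) vec, 'n) vec"

definition half_space :: "'n::{finite,linorder} rvec set" where
  "half_space = {x. 0 \<le> x $ Max UNIV}"

text \<open>
  Derivative at a point of the half-space. It only depends on the germ of the map in the
  half-space, is one-sided in the last coordinate at boundary points, and is unique, since
  within the half-space every coordinate direction or its opposite is available.
\<close>

definition D :: "('n::{finite,linorder} rvec \<Rightarrow> 'b::real_normed_vector) \<Rightarrow>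
    'n rvec \<Rightarrow> 'n rvec \<Rightarrow> 'b" where
  "D f x = frechet_derivative f (at x within half_space)"

text \<open>\<open>C\<^sup>k\<close> maps on an \<^emph>\<open>open\<close> set \<open>U\<close>.\<close>

fun Ck_on :: "nat \<Rightarrow> ('a::euclidean_space \<Rightarrow> 'b::real_normed_vector) \<Rightarrow> 'a set \<Rightarrow> bool" where
  "Ck_on 0 f U \<longleftrightarrow> continuous_on U f"
| "Ck_on (Suc k) f U \<longleftrightarrow> (\<forall>x\<in>U. f differentiable (at x)) \<and>
     (\<forall>v. Ck_on k (\<lambda>x. frechet_derivative f (at x) v) U)"

text \<open>
  Smoothness on an arbitrary subset: locally the restriction of a smooth map defined on an
  open subset of the ambient space. This is the usual notion at boundary points.
\<close>

definition smooth_on :: "'a::euclidean_space set \<Rightarrow> ('a \<Rightarrow> 'b::real_normed_vector) \<Rightarrow> bool" where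
  "smooth_on S f \<longleftrightarrow> (\<forall>x\<in>S. \<exists>U F. open U \<and> x \<in> U \<and> (\<forall>k. Ck_on k F U) \<and>
     (\<forall>y\<in>U \<inter> S. F y = f y))"

section \<open>Oriented smooth manifolds with boundary\<close>

text \<open>A chart is a pair of its domain and its coordinate map (irrelevant off the domain).\<close>

type_synonym ('a, 'n) chart = "'a set \<times> ('a \<Rightarrow> 'n rvec)"

definition is_chart :: "'a topology \<Rightarrow> ('a, 'n::{finite,linorder}) chart \<Rightarrow> bool" where
  "is_chart X c \<longleftrightarrow> openin X (fst c) \<and>
     openin (top_of_set half_space) (snd c ` fst c) \<and>
     homeomorphic_map (subtopology X (fst c)) (top_of_set (snd c ` fst c)) (snd c)"

definition chart_inv :: "('a, 'n::{finite,linorder}) chart \<Rightarrow> 'n rvec \<Rightarrow> 'a" where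
  "chart_inv c = inv_into (fst c) (snd c)"

definition transition ::
    "('a, 'n::{finite,linorder}) chart \<Rightarrow> ('a, 'n) chart \<Rightarrow> 'n rvec \<Rightarrow> 'n rvec" where
  "transition c d = snd d \<circ> chart_inv c"

definition jac ::
    "('a, 'n::{finite,linorder}) chart \<Rightarrow> ('a, 'n) chart \<Rightarrow> 'a \<Rightarrow> 'n rvec \<Rightarrow> 'n rvec" where
  "jac c d p = D (transition c d) (snd c p)"

text \<open>
  The orientation is given by the atlas, which consists of positively oriented charts.
  (In dimension at least 2, every oriented manifold with boundary is covered by positively
  oriented charts into this half-space.)
\<close>

definition oriented_manifold ::
    "'a topology \<Rightarrow> ('a, 'n::{finite,linorder}) chart set \<Rightarrow> bool" where
  "oriented_manifold X A \<longleftrightarrow>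
     Hausdorff_space X \<and> second_countable X \<and>
     (\<forall>c\<in>A. is_chart X c) \<and>
     (\<Union>c\<in>A. fst c) = topspace X \<and>
     (\<forall>c\<in>A. \<forall>d\<in>A. smooth_on (snd c ` (fst c \<inter> fst d)) (transition c d)) \<and>
     (\<forall>c\<in>A. \<forall>d\<in>A. \<forall>p\<in>fst c \<inter> fst d. det (matrix (jac c d p)) > 0)"

definition smooth_function ::
    "('a, 'n::{finite,linorder}) chart set \<Rightarrow> ('a \<Rightarrow> real) \<Rightarrow> bool" where
  "smooth_function A f \<longleftrightarrow> (\<forall>c\<in>A. smooth_on (snd c ` fst c) (f \<circ> chart_inv c))"

section \<open>Tensor fields\<close>

text \<open>
  A tensor field is the family of its local representatives: for a chart \<open>c\<close> and a point \<open>p\<close>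
  in the domain of \<open>c\<close>, its components at \<open>p\<close> with respect to the coordinate frame
  \<open>\<partial>\<^sub>1, \<dots>, \<partial>\<^sub>n\<close> of \<open>c\<close>. Representatives in different charts are related by the tensorial
  transformation law; values for \<open>p\<close> outside the domain are irrelevant.
\<close>

type_synonym ('a, 'n, 'b) field = "('a, 'n) chart \<Rightarrow> 'a \<Rightarrow> 'b"

definition loc ::
    "('a, 'n::{finite,linorder}, 'b) field \<Rightarrow> ('a, 'n) chart \<Rightarrow> 'n rvec \<Rightarrow> 'b" where
  "loc T c = T c \<circ> chart_inv c"

text \<open>A metric has the matrix of components \<open>g\<^sub>i\<^sub>j\<close> as its representative.\<close>

definition riemannian_metric :: "('a, 'n::{finite,linorder}) chart set \<Rightarrow>
    ('a, 'n, 'n rmat) field \<Rightarrow> bool" where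
  "riemannian_metric A g \<longleftrightarrow>
     (\<forall>c\<in>A. smooth_on (snd c ` fst c) (loc g c)) \<and>
     (\<forall>c\<in>A. \<forall>p\<in>fst c. transpose (g c p) = g c p \<and> (\<forall>v. v \<noteq> 0 \<longrightarrow> v \<bullet> (g c p *v v) > 0)) \<and>
     (\<forall>c\<in>A. \<forall>d\<in>A. \<forall>p\<in>fst c \<inter> fst d. \<forall>v w.
        v \<bullet> (g c p *v w) = jac c d p v \<bullet> (g d p *v jac c d p w))"

definition conformal_class :: "('a, 'n::{finite,linorder}) chart set \<Rightarrow>
    ('a, 'n, 'n rmat) field \<Rightarrow> ('a, 'n, 'n rmat) field set" where
  "conformal_class A g = {h. riemannian_metric A h \<and>
     (\<exists>u. smooth_function A u \<and> (\<forall>c\<in>A. \<forall>p\<in>fst c. h c p = exp (2 * u p) *\<^sub>R g c p))}"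

section \<open>Differential forms\<close>

text \<open>
  A \<open>k\<close>-form takes a list of \<open>k\<close> vectors; its values on lists of other lengths are
  irrelevant.
\<close>

type_synonym ('a, 'n) form = "('a, 'n, 'n rvec list \<Rightarrow> real) field"

definition alternating_form :: "nat \<Rightarrow> ('n::finite rvec list \<Rightarrow> real) \<Rightarrow> bool" where
  "alternating_form k \<omega> \<longleftrightarrow>
     (\<forall>vs i. length vs = k \<longrightarrow> i < k \<longrightarrow> linear (\<lambda>v. \<omega> (vs[i := v]))) \<and>
     (\<forall>vs i j. length vs = k \<longrightarrow> i < j \<longrightarrow> j < k \<longrightarrow> vs ! i = vs ! j \<longrightarrow> \<omega> vs = 0)"

definition differential_form ::
    "('a, 'n::{finite,linorder}) chart set \<Rightarrow> nat \<Rightarrow> ('a, 'n) form \<Rightarrow> bool" where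
  "differential_form A k \<omega> \<longleftrightarrow>
     (\<forall>c\<in>A. \<forall>p\<in>fst c. alternating_form k (\<omega> c p)) \<and>
     (\<forall>c\<in>A. \<forall>vs. length vs = k \<longrightarrow> smooth_on (snd c ` fst c) (\<lambda>x. loc \<omega> c x vs)) \<and>
     (\<forall>c\<in>A. \<forall>d\<in>A. \<forall>p\<in>fst c \<inter> fst d. \<forall>vs. length vs = k \<longrightarrow>
        \<omega> c p vs = \<omega> d p (map (jac c d p) vs))"

definition nowhere_vanishing ::
    "('a, 'n::{finite,linorder}) chart set \<Rightarrow> nat \<Rightarrow> ('a, 'n) form \<Rightarrow> bool" where
  "nowhere_vanishing A k \<omega> \<longleftrightarrow> (\<forall>c\<in>A. \<forall>p\<in>fst c. \<exists>vs. length vs = k \<and> \<omega> c p vs \<noteq> 0)"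

text \<open>
  \<open>d\<omega>(v\<^sub>0, \<dots>, v\<^sub>k) = \<Sum>\<^sub>i (-1)\<^sup>i v\<^sub>i(\<omega>(v\<^sub>0, \<dots>, v\<^sub>i\<^sub>-\<^sub>1, v\<^sub>i\<^sub>+\<^sub>1, \<dots>, v\<^sub>k))\<close> for vector fields \<open>v\<^sub>i\<close> with
  constant components in the chart, so that the bracket terms vanish.
\<close>

definition ext_deriv :: "('a, 'n::{finite,linorder}) form \<Rightarrow> ('a, 'n) form" where
  "ext_deriv \<omega> c p vs =
     (\<Sum>i<length vs. (-1) ^ i * D (\<lambda>x. loc \<omega> c x (take i vs @ drop (Suc i) vs)) (snd c p) (vs ! i))"

definition closed_form ::
    "('a, 'n::{finite,linorder}) chart set \<Rightarrow> nat \<Rightarrow> ('a, 'n) form \<Rightarrow> bool" where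
  "closed_form A k \<omega> \<longleftrightarrow>
     (\<forall>c\<in>A. \<forall>p\<in>fst c. \<forall>vs. length vs = Suc k \<longrightarrow> ext_deriv \<omega> c p vs = 0)"

definition interior_product ::
    "('a, 'n, 'n rvec) field \<Rightarrow> ('a, 'n::{finite,linorder}) form \<Rightarrow> ('a, 'n) form" where
  "interior_product B \<omega> c p vs = \<omega> c p (B c p # vs)"

section \<open>Volume form, Hodge star and Levi-Civita connection\<close>

text \<open>
  \<open>\<mu> = \<surd>(det g) dx\<^sup>1 \<and> \<dots> \<and> dx\<^sup>n\<close>, where the index \<open>i\<close> is at position \<open>card {j. j < i}\<close>.
\<close>

definition volume_form ::
    "('a, 'n::{finite,linorder}, 'n rmat) field \<Rightarrow> ('a, 'n) form" where
  "volume_form g c p vs = sqrt (det (g c p)) * det (\<chi> i. vs ! card {j. j < i})"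

text \<open>
  The Hodge star of a \<open>k\<close>-form, with the convention \<open>\<alpha> \<and> \<star>\<omega> = \<langle>\<alpha>,\<omega>\<rangle> \<mu>\<close>. In components,
  \<open>(\<star>\<omega>)(v\<^sub>1, \<dots>, v\<^sub>n\<^sub>-\<^sub>k) = 1/k! \<omega>\<^bsup>i\<^sub>1\<dots>i\<^sub>k\<^esup> \<mu>(\<partial>\<^bsub>i\<^sub>1\<^esub>, \<dots>, \<partial>\<^bsub>i\<^sub>k\<^esub>, v\<^sub>1, \<dots>, v\<^sub>n\<^sub>-\<^sub>k)\<close> with indices raised
  by the inverse metric.
\<close>

definition hodge_star :: "nat \<Rightarrow> ('a, 'n::{finite,linorder}, 'n rmat) field \<Rightarrow>
    ('a, 'n) form \<Rightarrow> ('a, 'n) form" where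
  "hodge_star k g \<omega> c p vs =
     (\<Sum>is | length is = k. \<Sum>js | length js = k.
        (\<Prod>m<k. matrix_inv (g c p) $ (is ! m) $ (js ! m)) *
        \<omega> c p (map (\<lambda>j. axis j 1) js) *
        volume_form g c p (map (\<lambda>i. axis i 1) is @ vs)) / fact k"

definition partial :: "'n::{finite,linorder} \<Rightarrow> ('a, 'n, 'b::real_normed_vector) field \<Rightarrow>
    ('a, 'n, 'b) field" where
  "partial i T c p = D (loc T c) (snd c p) (axis i 1)"

text \<open>The Christoffel symbols \<open>\<Gamma>\<^sup>k\<^sub>i\<^sub>j\<close> of the Levi-Civita connection.\<close>

definition christoffel :: "('a, 'n::{finite,linorder}, 'n rmat) field \<Rightarrow>
    'n \<Rightarrow> 'n \<Rightarrow> 'n \<Rightarrow> ('a, 'n, real) field" where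
  "christoffel g k i j c p = 1/2 * (\<Sum>l\<in>UNIV. matrix_inv (g c p) $ k $ l *
     (partial i g c p $ j $ l + partial j g c p $ i $ l - partial l g c p $ i $ j))"

definition cov_deriv :: "('a, 'n::{finite,linorder}, 'n rmat) field \<Rightarrow>
    ('a, 'n, 'n rvec) field \<Rightarrow> ('a, 'n, 'n rvec) field \<Rightarrow> ('a, 'n, 'n rvec) field" where
  "cov_deriv g X Y c p =
     (\<chi> k. (\<Sum>i\<in>UNIV. X c p $ i * partial i Y c p $ k) +
          (\<Sum>i\<in>UNIV. \<Sum>j\<in>UNIV. christoffel g k i j c p * X c p $ i * Y c p $ j))"

section \<open>Force-free and geodesic flux forms\<close>

text \<open>The vector field \<open>B\<close> with \<open>\<iota>\<^sub>B \<mu> = \<beta>\<close>, for an \<open>(n-1)\<close>-form \<open>\<beta>\<close>.\<close>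

definition flux_field :: "('a, 'n::{finite,linorder}, 'n rmat) field \<Rightarrow>
    ('a, 'n) form \<Rightarrow> ('a, 'n, 'n rvec) field" where
  "flux_field g \<beta> c p =
     (THE b. \<forall>vs. length vs = CARD('n) - 1 \<longrightarrow>
        interior_product (\<lambda>_ _. b) (volume_form g) c p vs = \<beta> c p vs)"

definition force_free :: "('a, 'n::{finite,linorder}) chart set \<Rightarrow>
    ('a, 'n, 'n rmat) field \<Rightarrow> ('a, 'n) form \<Rightarrow> bool" where
  "force_free A g \<beta> \<longleftrightarrow>
     (\<forall>c\<in>A. \<forall>p\<in>fst c. \<forall>vs. length vs = 1 \<longrightarrow>
        interior_product (flux_field g \<beta>) (ext_deriv (hodge_star (CARD('n) - 1) g \<beta>)) c p vs = 0)"

definition geodesic :: "('a, 'n::{finite,linorder}) chart set \<Rightarrow>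
    ('a, 'n, 'n rmat) field \<Rightarrow> ('a, 'n) form \<Rightarrow> bool" where
  "geodesic A g \<beta> \<longleftrightarrow>
     (\<exists>\<rho>. smooth_function A \<rho> \<and> (\<forall>c\<in>A. \<forall>p\<in>fst c.
        cov_deriv g (flux_field g \<beta>) (flux_field g \<beta>) c p = \<rho> p *\<^sub>R flux_field g \<beta> c p))"

end

theory Submission
  imports Defs
begin

text \<open>
  Write \<open>B\<close> for the vector field of the flux form with respect to \<open>g\<close>, \<open>\<eta> = g(B, \<cdot>)\<close> for the dual
  1-form and \<open>N = g(B, B) > 0\<close>. Both conditions say that \<open>\<iota>\<^sub>B d(f \<eta>) = 0\<close> for a positive function \<open>f\<close>
  determined by the conformal factor, and the two rules giving \<open>f\<close> can be matched.

  \<^item> Since \<open>\<star>\<beta> = \<plusminus>\<eta>\<close>, the form is force-free with respect to \<open>g\<close> iff \<open>\<iota>\<^sub>B d\<eta> = 0\<close>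
    (\<open>force_free_iff\<close>).

  \<^item> From \<open>g(\<nabla>\<^sub>B B, \<cdot>) = \<iota>\<^sub>B d\<eta> + dN/2\<close> (\<open>cov_deriv_flux\<close>) it follows that
    \<open>\<iota>\<^sub>B d(\<eta>/\<surd>N) = g(\<nabla>\<^sub>B B - (dN(B)/2N) B, \<cdot>)/\<surd>N\<close>. Hence \<open>\<beta>\<close> is geodesic iff
    \<open>\<iota>\<^sub>B d(\<eta>/\<surd>N) = 0\<close> (\<open>geodesic_iff\<close>): pairing \<open>\<nabla>\<^sub>B B = \<rho> B\<close> with \<open>B\<close> leaves \<open>\<rho> = dN(B)/2N\<close> as the
    only possible factor, and this function is smooth and globally defined.

  \<^item> For \<open>h = exp(2u) g\<close> one has \<open>\<mu>\<^sub>h = exp(n u) \<mu>\<close>, so that \<open>B\<^sub>h = exp(-n u) B\<close>,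
    \<open>\<eta>\<^sub>h = exp((2-n) u) \<eta>\<close> and \<open>\<eta>\<^sub>h/\<surd>N\<^sub>h = exp(u) \<eta>/\<surd>N\<close> (\<open>conformal_quantities\<close>).

  Thus \<open>exp(2v) g\<close> makes \<open>\<beta>\<close> force-free iff \<open>f = exp((2-n) v)\<close> solves the equation, and \<open>exp(2u) g\<close>
  makes it geodesic iff \<open>f = exp(u)/\<surd>N\<close> does. These are the same function when
  \<open>u = (2-n) v + ln N / 2\<close> (\<open>force_free_iff_geodesic\<close>). Given \<open>v\<close> this determines \<open>u\<close>, and as \<open>n \<noteq> 2\<close> it
  also determines \<open>v\<close> from \<open>u\<close>.

  The rest is the groundwork for these computations in charts: smooth functions on relatively open
  subsets of the half-space are closed under the operations involved, an \<open>(n-1)\<close>-form is the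
  contraction of the volume form with a unique vector, and the scalars \<open>N\<close> and \<open>dN(B)/2N\<close> do not
  depend on the chart.
\<close>


section \<open>Calculus of smooth maps\<close>

lemma Ck_on_subset: "Ck_on k f U \<Longrightarrow> V \<subseteq> U \<Longrightarrow> Ck_on k f V"
  by (induction k arbitrary: f) (auto intro: continuous_on_subset)

lemma Ck_on_cong:
  assumes "open U" "\<And>x. x \<in> U \<Longrightarrow> f x = g x" "Ck_on k f U"
  shows "Ck_on k g U"
  using assms(2,3)
proof (induction k arbitrary: f g)
  case 0
  then show ?case using continuous_on_cong[of U U f g] by simp
next
  case (Suc k)
  have eq: "(f has_derivative f') (at x) \<longleftrightarrow> (g has_derivative f') (at x)" if "x \<in> U" for x f'
    using has_derivative_transform_within_open[of _ f' x UNIV U] that \<open>open U\<close> Suc.prems(1)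
    by metis
  have "frechet_derivative f (at x) = frechet_derivative g (at x)" if "x \<in> U" for x
    unfolding frechet_derivative_def using eq[OF that] by simp
  moreover have "g differentiable (at x)" if "x \<in> U" for x
    using Suc.prems(2) that eq[OF that] unfolding Ck_on.simps differentiable_def by metis
  ultimately show ?case using Suc.prems(2) Suc.IH
    by (metis (no_types, lifting) Ck_on.simps(2))
qed

text \<open>
  The inductive step of every closure property below: it suffices to exhibit some formula for the
  derivative on \<open>U\<close> whose directional components are \<open>C\<^sup>k\<close>.
\<close>

lemma Ck_on_SucI:
  assumes "open U" "\<And>x. x \<in> U \<Longrightarrow> (f has_derivative f' x) (at x)"
    "\<And>v. Ck_on k (\<lambda>x. f' x v) U"
  shows "Ck_on (Suc k) f U"
proof -
  have "frechet_derivative f (at x) = f' x" if "x \<in> U" for x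
    using frechet_derivative_at[OF assms(2)[OF that]] by simp
  then have "Ck_on k (\<lambda>x. frechet_derivative f (at x) v) U" for v
    by (intro Ck_on_cong[OF assms(1) _ assms(3)]) simp
  then show ?thesis using assms(2) unfolding Ck_on.simps differentiable_def by metis
qed

lemma Ck_on_SucD:
  assumes "Ck_on (Suc k) f U" "x \<in> U"
  shows "(f has_derivative frechet_derivative f (at x)) (at x)"
  using assms frechet_derivative_works by auto

lemma Ck_on_Suc_imp_Ck_on: "Ck_on (Suc k) f U \<Longrightarrow> Ck_on k f U"
proof (induction k arbitrary: f)
  case 0
  then have "f differentiable_on U"
    by (auto simp: differentiable_on_def intro: differentiable_at_withinI)
  then show ?case by (simp add: differentiable_imp_continuous_on)
next
  case (Suc k)
  then show ?case by (metis Ck_on.simps(2))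
qed

lemma Ck_on_const: "Ck_on k (\<lambda>x. a) U"
  by (induction k arbitrary: a) auto

lemma Ck_on_add:
  assumes "open U" "Ck_on k f U" "Ck_on k g U"
  shows "Ck_on k (\<lambda>x. f x + g x) U"
  using assms(2,3)
proof (induction k arbitrary: f g)
  case 0
  then show ?case by (simp add: continuous_on_add)
next
  case (Suc k)
  show ?case
  proof (rule Ck_on_SucI[OF \<open>open U\<close>])
    show "((\<lambda>x. f x + g x) has_derivative
        (\<lambda>v. frechet_derivative f (at x) v + frechet_derivative g (at x) v)) (at x)" if "x \<in> U" for x
      by (intro has_derivative_add Ck_on_SucD[OF Suc.prems(1) that] Ck_on_SucD[OF Suc.prems(2) that])
    show "Ck_on k (\<lambda>x. frechet_derivative f (at x) v + frechet_derivative g (at x) v) U" for v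
      using Suc.prems by (intro Suc.IH) auto
  qed
qed

lemma (in bounded_bilinear) Ck_on_bilinear:
  assumes "open U" "Ck_on k f U" "Ck_on k g U"
  shows "Ck_on k (\<lambda>x. prod (f x) (g x)) U"
  using assms(2,3)
proof (induction k arbitrary: f g)
  case 0
  then show ?case by (auto intro: continuous_on)
next
  case (Suc k)
  show ?case
  proof (rule Ck_on_SucI[OF \<open>open U\<close>])
    show "((\<lambda>x. prod (f x) (g x)) has_derivative
        (\<lambda>v. prod (f x) (frechet_derivative g (at x) v) + prod (frechet_derivative f (at x) v) (g x)))
        (at x)" if "x \<in> U" for x
      by (intro FDERIV Ck_on_SucD[OF Suc.prems(1) that] Ck_on_SucD[OF Suc.prems(2) that])
    show "Ck_on k (\<lambda>x. prod (f x) (frechet_derivative g (at x) v) +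
        prod (frechet_derivative f (at x) v) (g x)) U" for v
    proof -
      have "Ck_on k f U" "Ck_on k g U" using Suc.prems by (blast intro: Ck_on_Suc_imp_Ck_on)+
      moreover have "Ck_on k (\<lambda>x. frechet_derivative f (at x) v) U"
        "Ck_on k (\<lambda>x. frechet_derivative g (at x) v) U"
        using Suc.prems by simp_all
      ultimately show ?thesis by (intro Ck_on_add[OF \<open>open U\<close>] Suc.IH)
    qed
  qed
qed

lemma (in bounded_linear) Ck_on_linear:
  assumes "open U" "Ck_on k g U"
  shows "Ck_on k (\<lambda>x. f (g x)) U"
  using assms(2)
proof (induction k arbitrary: g)
  case 0
  then show ?case by (simp add: continuous_on)
next
  case (Suc k)
  show ?case
  proof (rule Ck_on_SucI[OF \<open>open U\<close>])
    show "((\<lambda>x. f (g x)) has_derivative (\<lambda>v. f (frechet_derivative g (at x) v))) (at x)"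
      if "x \<in> U" for x
      by (rule has_derivative[OF Ck_on_SucD[OF Suc.prems that]])
    show "Ck_on k (\<lambda>x. f (frechet_derivative g (at x) v)) U" for v
      using Suc.prems by (intro Suc.IH) simp
  qed
qed

lemma Ck_on_exp:
  fixes f :: "'a::euclidean_space \<Rightarrow> real"
  assumes "open U" "Ck_on k f U"
  shows "Ck_on k (\<lambda>x. exp (f x)) U"
  using assms(2)
proof (induction k)
  case 0
  then show ?case by (simp add: continuous_on_exp)
next
  case (Suc k)
  show ?case
  proof (rule Ck_on_SucI[OF \<open>open U\<close>])
    show "((\<lambda>x. exp (f x)) has_derivative
        (\<lambda>v. exp (f x) * frechet_derivative f (at x) v)) (at x)" if "x \<in> U" for x
      by (auto intro!: derivative_eq_intros Ck_on_SucD[OF Suc.prems that])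
    show "Ck_on k (\<lambda>x. exp (f x) * frechet_derivative f (at x) v) U" for v
      using Suc Ck_on_Suc_imp_Ck_on[OF Suc.prems]
      by (intro bounded_bilinear.Ck_on_bilinear[OF bounded_bilinear_mult \<open>open U\<close>]) auto
  qed
qed

lemma Ck_on_inverse:
  fixes f :: "'a::euclidean_space \<Rightarrow> real"
  assumes "open U" "Ck_on k f U" "\<And>x. x \<in> U \<Longrightarrow> f x \<noteq> 0"
  shows "Ck_on k (\<lambda>x. inverse (f x)) U"
  using assms(2)
proof (induction k)
  case 0
  then show ?case using assms(3) by (simp add: continuous_on_inverse)
next
  case (Suc k)
  show ?case
  proof (rule Ck_on_SucI[OF \<open>open U\<close>])
    show "((\<lambda>x. inverse (f x)) has_derivative
        (\<lambda>v. - 1 * (inverse (f x) * (frechet_derivative f (at x) v * inverse (f x))))) (at x)"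
      if "x \<in> U" for x
      using assms(3)[OF that]
      by (auto intro!: derivative_eq_intros Ck_on_SucD[OF Suc.prems that])
    show "Ck_on k (\<lambda>x. - 1 * (inverse (f x) * (frechet_derivative f (at x) v * inverse (f x)))) U" for v
      using Suc Ck_on_Suc_imp_Ck_on[OF Suc.prems]
      by (intro bounded_bilinear.Ck_on_bilinear[OF bounded_bilinear_mult \<open>open U\<close>] Ck_on_const) auto
  qed
qed

lemma Ck_on_ln:
  fixes f :: "'a::euclidean_space \<Rightarrow> real"
  assumes "open U" "Ck_on k f U" "\<And>x. x \<in> U \<Longrightarrow> f x > 0"
  shows "Ck_on k (\<lambda>x. ln (f x)) U"
proof (cases k)
  case 0
  then show ?thesis using assms by (simp add: continuous_on_ln less_imp_neq[THEN not_sym])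
next
  case (Suc m)
  have f: "Ck_on (Suc m) f U" using assms(2) Suc by simp
  show ?thesis unfolding Suc
  proof (rule Ck_on_SucI[OF \<open>open U\<close>])
    show "((\<lambda>x. ln (f x)) has_derivative
        (\<lambda>v. frechet_derivative f (at x) v * inverse (f x))) (at x)" if "x \<in> U" for x
      using assms(3)[OF that]
      by (auto intro!: derivative_eq_intros Ck_on_SucD[OF f that] simp: divide_inverse)
    show "Ck_on m (\<lambda>x. frechet_derivative f (at x) v * inverse (f x)) U" for v
      using assms(3) f Ck_on_Suc_imp_Ck_on[OF f]
      by (intro bounded_bilinear.Ck_on_bilinear[OF bounded_bilinear_mult \<open>open U\<close>]
          Ck_on_inverse[OF \<open>open U\<close>]) force+
  qed
qed

text \<open>
  Closure properties on open sets pass to smooth functions on arbitrary sets by applying them to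
  local extensions. An extension of \<open>f\<close> may leave the domain \<open>P\<close> of \<open>\<phi>\<close>, but only outside a smaller
  neighbourhood, because \<open>P\<close> is open.
\<close>

lemma smooth_on_lift1:
  fixes f :: "'a::euclidean_space \<Rightarrow> 'b::real_normed_vector"
    and \<phi> :: "'b \<Rightarrow> 'c::real_normed_vector"
  assumes "smooth_on S f" "open P" "\<And>x. x \<in> S \<Longrightarrow> f x \<in> P"
    and "\<And>(U :: 'a set) F k. open U \<Longrightarrow> Ck_on k F U \<Longrightarrow> (\<And>x. x \<in> U \<Longrightarrow> F x \<in> P) \<Longrightarrow>
      Ck_on k (\<lambda>x. \<phi> (F x)) U"
  shows "smooth_on S (\<lambda>x. \<phi> (f x))"
  unfolding smooth_on_def
proof
  fix x assume x: "x \<in> S"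
  then obtain U F where U: "open U" "x \<in> U" "\<And>k. Ck_on k F U" "\<And>y. y \<in> U \<inter> S \<Longrightarrow> F y = f y"
    using assms(1) unfolding smooth_on_def by metis
  define V where "V = U \<inter> F -` P"
  have "open V"
    unfolding V_def using U(1) U(3)[of 0] assms(2) by (auto intro: continuous_open_preimage)
  moreover have "x \<in> V" using U x assms(3) by (auto simp: V_def)
  moreover have "Ck_on k (\<lambda>x. \<phi> (F x)) V" for k
    using assms(4)[OF \<open>open V\<close>, of k F] Ck_on_subset[OF U(3)[of k], of V] by (auto simp: V_def)
  moreover have "\<forall>y\<in>V \<inter> S. \<phi> (F y) = \<phi> (f y)" using U(4) by (auto simp: V_def)
  ultimately show "\<exists>U F. open U \<and> x \<in> U \<and> (\<forall>k. Ck_on k F U) \<and> (\<forall>y\<in>U \<inter> S. F y = \<phi> (f y))"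
    by blast
qed

lemma smooth_on_lift2:
  fixes f :: "'a::euclidean_space \<Rightarrow> 'b::real_normed_vector"
    and g :: "'a \<Rightarrow> 'c::real_normed_vector"
    and \<phi> :: "'b \<Rightarrow> 'c \<Rightarrow> 'd::real_normed_vector"
  assumes "smooth_on S f" "smooth_on S g"
    and "\<And>(U :: 'a set) F G k. open U \<Longrightarrow> Ck_on k F U \<Longrightarrow> Ck_on k G U \<Longrightarrow> Ck_on k (\<lambda>x. \<phi> (F x) (G x)) U"
  shows "smooth_on S (\<lambda>x. \<phi> (f x) (g x))"
  unfolding smooth_on_def
proof
  fix x assume x: "x \<in> S"
  then obtain U F where U: "open U" "x \<in> U" "\<And>k. Ck_on k F U" "\<And>y. y \<in> U \<inter> S \<Longrightarrow> F y = f y"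
    using assms(1) unfolding smooth_on_def by metis
  obtain V G where V: "open V" "x \<in> V" "\<And>k. Ck_on k G V" "\<And>y. y \<in> V \<inter> S \<Longrightarrow> G y = g y"
    using x assms(2) unfolding smooth_on_def by metis
  have "Ck_on k (\<lambda>x. \<phi> (F x) (G x)) (U \<inter> V)" for k
    using assms(3)[of "U \<inter> V" k F G] U(1,3) V(1,3) by (auto intro: Ck_on_subset)
  moreover have "open (U \<inter> V)" "x \<in> U \<inter> V" "\<forall>y\<in>U \<inter> V \<inter> S. \<phi> (F y) (G y) = \<phi> (f y) (g y)"
    using U V by auto
  ultimately show "\<exists>U H. open U \<and> x \<in> U \<and> (\<forall>k. Ck_on k H U) \<and> (\<forall>y\<in>U \<inter> S. H y = \<phi> (f y) (g y))"
    by (metis (no_types, lifting))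
qed

lemma smooth_on_cong: "smooth_on S f \<Longrightarrow> (\<And>x. x \<in> S \<Longrightarrow> f x = g x) \<Longrightarrow> smooth_on S g"
  unfolding smooth_on_def by (metis IntD2)

lemma smooth_on_const: "smooth_on S (\<lambda>x. a)"
  unfolding smooth_on_def using Ck_on_const by (metis UNIV_I open_UNIV)

lemma smooth_on_add:
  "smooth_on S f \<Longrightarrow> smooth_on S g \<Longrightarrow> smooth_on S (\<lambda>x. f x + g x)"
  by (rule smooth_on_lift2) (auto intro: Ck_on_add)

lemma smooth_on_bilinear:
  "bounded_bilinear b \<Longrightarrow> smooth_on S f \<Longrightarrow> smooth_on S g \<Longrightarrow> smooth_on S (\<lambda>x. b (f x) (g x))"
  by (rule smooth_on_lift2) (auto intro: bounded_bilinear.Ck_on_bilinear)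

lemma smooth_on_linear: "bounded_linear l \<Longrightarrow> smooth_on S f \<Longrightarrow> smooth_on S (\<lambda>x. l (f x))"
  by (rule smooth_on_lift1[where P = UNIV]) (auto intro: bounded_linear.Ck_on_linear)

lemmas smooth_on_mult = smooth_on_bilinear[OF bounded_bilinear_mult]
  and smooth_on_scaleR = smooth_on_bilinear[OF bounded_bilinear_scaleR]
  and smooth_on_vec_nth = smooth_on_linear[OF bounded_linear_vec_nth]

lemma smooth_on_exp: "smooth_on S f \<Longrightarrow> smooth_on S (\<lambda>x. exp (f x :: real))"
  by (rule smooth_on_lift1[where P = UNIV]) (auto intro: Ck_on_exp)

lemma smooth_on_inverse:
  "smooth_on S f \<Longrightarrow> (\<And>x. x \<in> S \<Longrightarrow> f x \<noteq> 0) \<Longrightarrow> smooth_on S (\<lambda>x. inverse (f x :: real))"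
  by (rule smooth_on_lift1[where P = "- {0}" and \<phi> = inverse]) (auto intro: Ck_on_inverse)

lemma smooth_on_ln:
  "smooth_on S f \<Longrightarrow> (\<And>x. x \<in> S \<Longrightarrow> f x > 0) \<Longrightarrow> smooth_on S (\<lambda>x. ln (f x :: real))"
  by (rule smooth_on_lift1[where P = "{0<..}" and \<phi> = ln]) (auto intro: Ck_on_ln)

lemma smooth_on_sqrt:
  assumes "smooth_on S f" "\<And>x. x \<in> S \<Longrightarrow> f x > 0"
  shows "smooth_on S (\<lambda>x. sqrt (f x))"
proof (rule smooth_on_cong)
  show "smooth_on S (\<lambda>x. exp (1/2 * ln (f x)))"
    by (intro smooth_on_exp smooth_on_mult smooth_on_const smooth_on_ln assms)
  show "exp (1/2 * ln (f x)) = sqrt (f x)" if "x \<in> S" for x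
    using assms(2)[OF that] by (simp add: powr_half_sqrt[symmetric] powr_def)
qed

lemma smooth_on_sum:
  "(\<And>i. i \<in> I \<Longrightarrow> smooth_on S (f i)) \<Longrightarrow> smooth_on S (\<lambda>x. \<Sum>i\<in>I. f i x)"
  by (induction I rule: infinite_finite_induct) (auto intro: smooth_on_const smooth_on_add)

lemma smooth_on_prod:
  "(\<And>i. i \<in> I \<Longrightarrow> smooth_on S (f i)) \<Longrightarrow> smooth_on S (\<lambda>x. \<Prod>i\<in>I. f i x :: real)"
  by (induction I rule: infinite_finite_induct) (auto intro: smooth_on_const smooth_on_mult)

lemma smooth_on_vec:
  fixes f :: "'a::euclidean_space \<Rightarrow> (real, 'n::finite) vec"
  assumes "\<And>i. smooth_on S (\<lambda>x. f x $ i)"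
  shows "smooth_on S f"
proof -
  have "smooth_on S (\<lambda>x. \<Sum>i\<in>UNIV. (f x $ i) *\<^sub>R axis i 1)"
    by (intro smooth_on_sum smooth_on_scaleR smooth_on_const assms)
  moreover have "(\<Sum>i\<in>UNIV. (f x $ i) *\<^sub>R axis i 1) = f x" for x
    using basis_expansion[of "f x"] by (simp add: scalar_mult_eq_scaleR)
  ultimately show ?thesis by (rule smooth_on_cong)
qed

lemma smooth_on_det:
  fixes f :: "'a::euclidean_space \<Rightarrow> ((real, 'n::finite) vec, 'n) vec"
  assumes "smooth_on S f"
  shows "smooth_on S (\<lambda>x. det (f x))"
  unfolding det_def
  by (intro smooth_on_sum smooth_on_mult smooth_on_const smooth_on_prod smooth_on_vec_nth assms)

lemma bounded_bilinear_matrix_vector_mult: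
  "bounded_bilinear ((*v) :: (real, 'n::finite) vec ^ 'm::finite \<Rightarrow> _)"
  unfolding bilinear_conv_bounded_bilinear[symmetric] bilinear_def
  by (auto intro!: linearI simp: matrix_vector_right_distrib matrix_vector_mult_add_rdistrib
      matrix_vector_mult_scaleR scaleR_matrix_vector_assoc)

text \<open>
  At boundary points the derivative is still unique: one can move a little in every positive
  coordinate direction without leaving the half-space.
\<close>

lemma has_derivative_half_space_unique:
  fixes f :: "'n::{finite,linorder} rvec \<Rightarrow> 'b::real_normed_vector"
  assumes "x \<in> half_space" "(f has_derivative f') (at x within half_space)"
    "(f has_derivative f'') (at x within half_space)"
  shows "f' = f''"
proof (rule frechet_derivative_unique_within[OF assms(2,3)])
  fix i :: "'n rvec" and e :: real
  assume i: "i \<in> Basis" "0 < e"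
  then obtain k where k: "i = axis k 1" by (auto simp: Basis_vec_def)
  have "x + (e/2) *\<^sub>R i \<in> half_space"
    using assms(1) \<open>0 < e\<close> by (simp add: half_space_def k axis_def)
  then show "\<exists>d. 0 < \<bar>d\<bar> \<and> \<bar>d\<bar> < e \<and> x + d *\<^sub>R i \<in> half_space"
    using \<open>0 < e\<close> by (intro exI[of _ "e/2"]) auto
qed

lemma D_eqI:
  "x \<in> half_space \<Longrightarrow> (f has_derivative f') (at x within half_space) \<Longrightarrow> D f x = f'"
  unfolding D_def using has_derivative_half_space_unique frechet_derivative_works
  by (metis differentiableI)

lemma has_derivative_cong_rel_open:
  assumes "openin (top_of_set T) S" "x \<in> S" "\<And>y. y \<in> S \<Longrightarrow> f y = g y"
    "(f has_derivative f') (at x within T)"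
  shows "(g has_derivative f') (at x within T)"
proof -
  have "x \<in> T" using assms(1,2) openin_imp_subset by blast
  moreover have "\<forall>\<^sub>F y in at x within T. f y = g y"
    using assms(1-3) by (auto simp: openin_open eventually_at_topological)
  ultimately show ?thesis
    using has_derivative_transform_eventually[OF assms(4)] assms(2,3) by blast
qed

lemma D_cong:
  assumes "openin (top_of_set half_space) S" "x \<in> S" "\<And>y. y \<in> S \<Longrightarrow> f y = g y"
  shows "D f x = D g x"
proof -
  have "(f has_derivative f') (at x within half_space) \<longleftrightarrow>
      (g has_derivative f') (at x within half_space)" for f'
    using has_derivative_cong_rel_open[OF assms(1,2)] assms(3) by metis
  then show ?thesis by (simp add: D_def frechet_derivative_def)
qed

text \<open>
  A local extension \<open>F\<close> of \<open>f\<close> also extends the derivative: near \<open>x\<close>, the one-sided derivative of \<open>f\<close>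
  is the ordinary derivative of \<open>F\<close>, which is again smooth.
\<close>

lemma smooth_on_imp_D_extension:
  assumes "openin (top_of_set half_space) S" "smooth_on S f" "x \<in> S"
  obtains U F where "open U" "x \<in> U" "\<And>k. Ck_on k F U" "\<And>y. y \<in> U \<inter> S \<Longrightarrow> F y = f y"
    "\<And>y. y \<in> U \<inter> S \<Longrightarrow> (f has_derivative frechet_derivative F (at y)) (at y within half_space)"
    "\<And>y. y \<in> U \<inter> S \<Longrightarrow> D f y = frechet_derivative F (at y)"
proof -
  obtain U F where U: "open U" "x \<in> U" "\<And>k. Ck_on k F U" "\<And>y. y \<in> U \<inter> S \<Longrightarrow> F y = f y"
    using assms unfolding smooth_on_def by metis
  have "openin (top_of_set half_space) (U \<inter> S)"
    using assms(1) U(1) by (metis inf_commute openin_Int_open)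
  then have *: "(f has_derivative frechet_derivative F (at y)) (at y within half_space)"
    if "y \<in> U \<inter> S" for y
    using that U(4) has_derivative_at_withinI[OF Ck_on_SucD[OF U(3), of y]]
    by (auto intro: has_derivative_cong_rel_open)
  have "U \<inter> S \<subseteq> half_space" using assms(1) openin_imp_subset by blast
  then have "D f y = frechet_derivative F (at y)" if "y \<in> U \<inter> S" for y
    using D_eqI[OF _ *[OF that]] that by blast
  then show ?thesis using that[OF U *] by blast
qed

lemma smooth_on_has_derivative_D:
  assumes "openin (top_of_set half_space) S" "smooth_on S f" "x \<in> S"
  shows "(f has_derivative D f x) (at x within half_space)"
  by (rule smooth_on_imp_D_extension[OF assms]) (use assms(3) in auto)

lemma smooth_on_D:
  assumes "openin (top_of_set half_space) S" "smooth_on S f"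
  shows "smooth_on S (\<lambda>x. D f x v)"
  unfolding smooth_on_def
proof
  fix x assume "x \<in> S"
  from smooth_on_imp_D_extension[OF assms this] obtain U F where
    U: "open U" "x \<in> U" "\<And>k. Ck_on k F U" "\<And>y. y \<in> U \<inter> S \<Longrightarrow> D f y = frechet_derivative F (at y)"
    by metis
  have "\<forall>k. Ck_on k (\<lambda>y. frechet_derivative F (at y) v) U"
    using U(3)[of "Suc _"] by simp
  with U show "\<exists>U F. open U \<and> x \<in> U \<and> (\<forall>k. Ck_on k F U) \<and> (\<forall>y\<in>U \<inter> S. F y = D f y v)"
    by (intro exI[of _ U] exI[of _ "\<lambda>y. frechet_derivative F (at y) v"]) auto
qed

lemma smooth_on_D_field:
  fixes f :: "'n::{finite,linorder} rvec \<Rightarrow> real"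
  assumes "openin (top_of_set half_space) S" "smooth_on S f" "smooth_on S b"
  shows "smooth_on S (\<lambda>x. D f x (b x))"
proof (rule smooth_on_cong)
  show "smooth_on S (\<lambda>x. \<Sum>i\<in>UNIV. b x $ i * D f x (axis i 1))"
    by (intro smooth_on_sum smooth_on_mult smooth_on_vec_nth smooth_on_D assms)
  fix x assume "x \<in> S"
  then interpret linear "D f x"
    using smooth_on_has_derivative_D[OF assms(1,2)] has_derivative_linear by blast
  have "D f x (\<Sum>i\<in>UNIV. (b x $ i) *\<^sub>R axis i 1) = (\<Sum>i\<in>UNIV. b x $ i * D f x (axis i 1))"
    by (simp add: sum scale)
  then show "(\<Sum>i\<in>UNIV. b x $ i * D f x (axis i 1)) = D f x (b x)"
    using basis_expansion[of "b x"] by (simp add: scalar_mult_eq_scaleR)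
qed


section \<open>Alternating forms\<close>

lemma alternating_form_linear:
  "alternating_form k \<omega> \<Longrightarrow> length vs = k \<Longrightarrow> i < k \<Longrightarrow> linear (\<lambda>v. \<omega> (vs[i := v]))"
  by (simp add: alternating_form_def)

lemma alternating_form_eq_0:
  "alternating_form k \<omega> \<Longrightarrow> length vs = k \<Longrightarrow> \<not> distinct vs \<Longrightarrow> \<omega> vs = 0"
  unfolding alternating_form_def distinct_conv_nth by (metis nat_neq_iff)

lemma alternating_form_Cons:
  assumes "alternating_form (Suc k) \<omega>"
  shows "alternating_form k (\<lambda>vs. \<omega> (v # vs))"
  unfolding alternating_form_def
proof (intro conjI allI impI)
  show "linear (\<lambda>u. \<omega> (v # vs[i := u]))" if "length vs = k" "i < k" for vs i
    using alternating_form_linear[OF assms, of "v # vs" "Suc i"] that by simp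
  show "\<omega> (v # vs) = 0" if "length vs = k" "i < j" "j < k" "vs ! i = vs ! j" for vs i j
    using alternating_form_eq_0[OF assms, of "v # vs"] that nth_eq_iff_index_eq[of vs i j] by auto
qed

lemma alternating_form_diff:
  assumes "alternating_form k \<omega>" "alternating_form k \<eta>"
  shows "alternating_form k (\<lambda>vs. \<omega> vs - \<eta> vs)"
  using assms unfolding alternating_form_def by (auto intro: linear_compose_sub)

lemma alternating_form_swap:
  assumes "alternating_form k \<omega>" "length vs = k" "i < k" "j < k" "i \<noteq> j"
  shows "\<omega> (vs[i := vs ! j, j := vs ! i]) = - \<omega> vs"
proof -
  define f where "f a b = \<omega> (vs[i := a, j := b])" for a b
  have lin2: "linear (\<lambda>b. f a b)" for a
    unfolding f_def using assms by (intro alternating_form_linear) auto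
  have lin1: "linear (\<lambda>a. f a b)" for b
    unfolding f_def list_update_swap[OF assms(5)] using assms
    by (intro alternating_form_linear) auto
  have same: "f a a = 0" for a
    unfolding f_def
  proof (rule alternating_form_eq_0[OF assms(1)])
    show "\<not> distinct (vs[i := a, j := a])"
      using nth_eq_iff_index_eq[of "vs[i := a, j := a]" i j] assms by (auto simp: nth_list_update)
  qed (simp add: assms)
  let ?a = "vs ! i" and ?b = "vs ! j"
  have "f (?a + ?b) (?a + ?b) = f ?a ?a + f ?a ?b + (f ?b ?a + f ?b ?b)"
    by (simp add: linear_add[OF lin1] linear_add[OF lin2])
  then have "f ?b ?a = - f ?a ?b" by (simp add: same)
  then show ?thesis by (simp add: f_def)
qed

text \<open>
  Adjacent transpositions carry \<open>v\<close> to the front, one sign for each vector passed.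
\<close>

lemma alternating_form_move:
  assumes "alternating_form k \<omega>" "length xs + Suc (length ys) = k"
  shows "\<omega> (xs @ v # ys) = (-1) ^ length xs * \<omega> (v # xs @ ys)"
  using assms(2)
proof (induction xs arbitrary: ys rule: rev_induct)
  case (snoc a xs)
  have "\<omega> (xs @ a # v # ys) = - \<omega> (xs @ v # a # ys)"
    using alternating_form_swap[OF assms(1), of "xs @ v # a # ys" "length xs" "Suc (length xs)"]
      snoc.prems by (simp add: nth_append list_update_append)
  then show ?case using snoc.IH[of "a # ys"] snoc.prems by simp
qed simp

text \<open>
  Exchanging two arguments only changes the sign, so vanishing does not depend on the order of
  the arguments.
\<close>

lemma alternating_form_permuted_eq_0:
  assumes "alternating_form k \<omega>" "length vs = k" "mset ws = mset vs" "\<omega> vs = 0"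
  shows "\<omega> ws = 0"
proof -
  obtain p where p: "p permutes {..<k}" "permute_list p vs = ws"
    using mset_eq_permutation[OF assms(3)] assms(2) by metis
  have "\<omega> (permute_list p us) = 0" if "length us = k" "\<omega> us = 0" for us
    using p(1) finite_lessThan that
  proof (induction arbitrary: us rule: permutes_induct)
    case (swap a b q)
    let ?u = "permute_list (Transposition.transpose a b) us"
    have "?u = us[a := us ! b, b := us ! a]"
      using swap.hyps swap.prems
      by (intro nth_equalityI) (auto simp: permute_list_def nth_list_update transpose_def)
    then have "\<omega> ?u = 0"
      using alternating_form_swap[OF assms(1)] swap.hyps swap.prems by simp
    moreover have "permute_list (Transposition.transpose a b \<circ> q) us = permute_list q ?u"
      using swap.hyps swap.prems by (intro permute_list_compose) simp
    ultimately show ?case using swap.IH[of ?u] swap.prems by (simp only: length_permute_list)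
  qed auto
  then show ?thesis using p(2) assms by blast
qed

lemma linear_expansion:
  fixes f :: "'n::finite rvec \<Rightarrow> real"
  assumes "linear f"
  shows "f v = (\<Sum>i\<in>UNIV. v $ i * f (axis i 1))"
proof -
  have "f v = f (\<Sum>i\<in>UNIV. (v $ i) *\<^sub>R axis i 1)"
    using basis_expansion[of v] by (simp add: scalar_mult_eq_scaleR)
  then show ?thesis by (simp add: linear_sum[OF assms] linear_scale[OF assms])
qed

text \<open>
  The sum over index lists is the shape in which the Hodge star is defined, so this lemma serves
  both to compare alternating forms and to raise indices.
\<close>

lemma multilinear_expansion:
  fixes f :: "'n::finite rvec list \<Rightarrow> real"
  assumes "\<And>vs i. length vs = k \<Longrightarrow> i < k \<Longrightarrow> linear (\<lambda>v. f (vs[i := v]))" "length vs = k"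
  shows "f vs = (\<Sum>js | length js = k. (\<Prod>m<k. vs ! m $ (js ! m)) * f (map (\<lambda>j. axis j 1) js))"
  using assms
proof (induction k arbitrary: f vs)
  case 0
  then show ?case by simp
next
  case (Suc k)
  obtain v ws where vs: "vs = v # ws" "length ws = k"
    using Suc.prems(2) by (auto simp: length_Suc_conv)
  let ?E = "map (\<lambda>j. axis j 1) :: 'n list \<Rightarrow> 'n rvec list"
  have IH: "f (axis i 1 # ws) =
      (\<Sum>js | length js = k. (\<Prod>m<k. ws ! m $ (js ! m)) * f (axis i 1 # ?E js))" for i
    using Suc.prems(1)[of "axis i 1 # _" "Suc _"] vs(2)
    by (intro Suc.IH[where f = "\<lambda>us. f (axis i 1 # us)"]) auto
  have "f vs = (\<Sum>i\<in>UNIV. v $ i * f (axis i 1 # ws))"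
    using linear_expansion[OF Suc.prems(1)[of vs 0], of v] vs by simp
  also have "\<dots> = (\<Sum>i\<in>UNIV. v $ i *
      (\<Sum>js | length js = k. (\<Prod>m<k. ws ! m $ (js ! m)) * f (axis i 1 # ?E js)))"
    using IH by simp
  also have "\<dots> = (\<Sum>(i, js)\<in>UNIV \<times> {js. length js = k}.
      (v $ i * (\<Prod>m<k. ws ! m $ (js ! m))) * f (?E (i # js)))"
    by (simp add: sum.cartesian_product[symmetric] sum_distrib_left mult.assoc)
  also have "\<dots> = (\<Sum>js | length js = Suc k. (\<Prod>m<Suc k. vs ! m $ (js ! m)) * f (?E js))"
    by (rule sum.reindex_bij_witness[of _ "\<lambda>js. (hd js, tl js)" "\<lambda>(i, js). i # js"])
      (auto simp: length_Suc_conv vs prod.lessThan_Suc_shift simp del: prod.lessThan_Suc)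
  finally show ?case .
qed

section \<open>Determinants of lists of vectors\<close>

text \<open>The rows are placed in the order of the index type, as in the volume form.\<close>

definition list_det :: "'n::{finite,linorder} rvec list \<Rightarrow> real" where
  "list_det vs = det (\<chi> i. vs ! card {j. j < i})"

lemma volume_form_eq_list_det: "volume_form g c p vs = sqrt (det (g c p)) * list_det vs"
  by (simp add: volume_form_def list_det_def)

lemma rank_less: "card {j::'n::{finite,linorder}. j < i} < CARD('n)"
  by (intro psubset_card_mono) auto

lemma rank_eq_iff: "card {j::'n::{finite,linorder}. j < a} = card {j. j < b} \<longleftrightarrow> a = b"
proof -
  have "card {j::'n. j < a} < card {j. j < b}" if "a < b" for a b
    using that by (intro psubset_card_mono) auto
  then show ?thesis by (metis less_irrefl linorder_less_linear)
qed

lemma bij_betw_rank: "bij_betw (\<lambda>i::'n::{finite,linorder}. card {j. j < i}) UNIV {..<CARD('n)}"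
proof -
  have inj: "inj (\<lambda>i::'n. card {j. j < i})" by (auto simp: inj_def rank_eq_iff)
  moreover have "range (\<lambda>i::'n. card {j. j < i}) = {..<CARD('n)}"
    using card_image[OF inj] by (intro card_subset_eq) (auto simp: rank_less)
  ultimately show ?thesis by (simp add: bij_betw_def)
qed

lemma obtain_rank:
  assumes "m < CARD('n)"
  obtains i :: "'n::{finite,linorder}" where "card {j. j < i} = m"
proof -
  have "m \<in> range (\<lambda>i::'n. card {j. j < i})"
    using bij_betw_imp_surj_on[OF bij_betw_rank[where 'n = 'n]] assms by simp
  then show ?thesis using that by auto
qed

lemma alternating_form_list_det:
  "alternating_form CARD('n) (list_det :: 'n::{finite,linorder} rvec list \<Rightarrow> real)"
  unfolding alternating_form_def
proof (intro conjI allI impI)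
  fix vs :: "'n rvec list" and m assume m: "length vs = CARD('n)" "m < CARD('n)"
  obtain k :: 'n where k: "card {j. j < k} = m" using obtain_rank[OF m(2)] .
  have "vs[m := v] ! card {j. j < i} = (if i = k then v else vs ! card {j. j < i})" for v i
    using m rank_less[of i] rank_eq_iff[of k i] by (auto simp: k nth_list_update)
  then have "list_det (vs[m := v]) = det (\<chi> i. if i = k then v else vs ! card {j. j < i})" for v
    by (simp add: list_det_def)
  moreover have "linear (\<lambda>v. det (\<chi> i. if i = k then v else vs ! card {j. j < i}))"
  proof (rule linearI)
    show "det (\<chi> i. if i = k then a + b else vs ! card {j. j < i}) =
        det (\<chi> i. if i = k then a else vs ! card {j. j < i}) +
        det (\<chi> i. if i = k then b else vs ! card {j. j < i})" for a b
      by (rule det_row_add)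
    show "det (\<chi> i. if i = k then r *\<^sub>R a else vs ! card {j. j < i}) =
        r *\<^sub>R det (\<chi> i. if i = k then a else vs ! card {j. j < i})" for r a
      unfolding real_scaleR_def scalar_mult_eq_scaleR[symmetric] by (rule det_row_mul)
  qed
  ultimately show "linear (\<lambda>v. list_det (vs[m := v]))" by simp
next
  fix vs :: "'n rvec list" and m l
  assume ml: "length vs = CARD('n)" "m < l" "l < CARD('n)" "vs ! m = vs ! l"
  obtain a b :: 'n where ab: "card {j. j < a} = m" "card {j. j < b} = l"
    using ml obtain_rank by (metis order.strict_trans)
  have "row a (\<chi> i. vs ! card {j. j < i}) = row b (\<chi> i. vs ! card {j. j < i})"
    unfolding row_def by (simp add: ab ml(4))
  moreover have "a \<noteq> b" using ab ml(2) by blast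
  ultimately show "list_det vs = 0"
    unfolding list_det_def using det_identical_rows by blast
qed

lemma list_det_map_matrix:
  fixes M :: "'n::{finite,linorder} rmat"
  assumes "length vs = CARD('n)"
  shows "list_det (map ((*v) M) vs) = det M * list_det vs"
proof -
  have "((\<chi> i. map ((*v) M) vs ! card {j. j < i}) :: 'n rmat) = (\<chi> i. vs ! card {j. j < i}) ** transpose M"
  proof (intro vec_eq_iff[THEN iffD2] allI)
    fix i j :: 'n
    have "map ((*v) M) vs ! card {j. j < i} $ j = (\<Sum>k\<in>UNIV. M $ j $ k * vs ! card {j. j < i} $ k)"
      using assms rank_less[of i] by (simp add: matrix_vector_mult_def)
    then show "(\<chi> i. map ((*v) M) vs ! card {j. j < i}) $ i $ j =
        ((\<chi> i. vs ! card {j. j < i}) ** transpose M) $ i $ j"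
      by (simp add: matrix_matrix_mult_def transpose_def mult.commute[of "M $ j $ _"])
  qed
  then show ?thesis by (simp add: list_det_def det_mul det_transpose)
qed

text \<open>
  The matrix is a permutation matrix, hence orthogonal. Knowing the square of its determinant is
  enough: the sign itself always occurs twice or is divided out.
\<close>

lemma list_det_distinct_axes:
  fixes js :: "'n::{finite,linorder} list"
  assumes "length js = CARD('n)" "distinct js"
  shows "(list_det (map (\<lambda>j. axis j 1) js))\<^sup>2 = 1"
proof -
  let ?M = "\<chi> i. map (\<lambda>j. axis j 1) js ! card {j. j < i} :: 'n rmat"
  have row: "row i ?M = axis (js ! card {j. j < i}) 1" for i
    using assms(1) rank_less[of i] by (simp add: row_def vec_eq_iff)
  have "orthogonal_matrix ?M"
    unfolding orthogonal_matrix_orthonormal_rows row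
    using assms rank_less[where 'n = 'n]
    by (auto simp: orthogonal_def inner_axis_axis nth_eq_iff_index_eq rank_eq_iff)
  then show ?thesis using det_orthogonal_matrix unfolding list_det_def by fastforce
qed

text \<open>Every component of \<open>w\<close> in a direction listed in \<open>js\<close> only produces a repeated row.\<close>

lemma list_det_Cons_axes:
  fixes js :: "'n::{finite,linorder} list"
  assumes "length js = CARD('n) - 1" "UNIV - {i} \<subseteq> set js"
  shows "list_det (w # map (\<lambda>j. axis j 1) js) =
    w $ i * list_det (axis i 1 # map (\<lambda>j. axis j 1) js)"
proof -
  let ?E = "map (\<lambda>j. axis j 1) js :: 'n rvec list"
  have len: "length (v # ?E) = CARD('n)" for v using assms(1) by simp
  have "linear (\<lambda>v. list_det (v # ?E))"
    using alternating_form_linear[OF alternating_form_list_det, of "_ # ?E" 0] len by simp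
  then have "list_det (w # ?E) = (\<Sum>j\<in>UNIV. w $ j * list_det (axis j 1 # ?E))"
    by (rule linear_expansion)
  also have "\<dots> = (\<Sum>j\<in>{i}. w $ j * list_det (axis j 1 # ?E))"
  proof (intro sum.mono_neutral_right ballI)
    fix j assume "j \<in> UNIV - {i}"
    then have "\<not> distinct (axis j 1 # ?E)" using assms(2) by auto
    then show "w $ j * list_det (axis j 1 # ?E) = 0"
      using alternating_form_eq_0[OF alternating_form_list_det len] by simp
  qed auto
  finally show ?thesis by simp
qed

lemma distinct_missing_one:
  fixes js :: "'n::finite list"
  assumes "length js = CARD('n) - 1" "distinct js"
  obtains i where "set js = UNIV - {i}"
proof -
  have "card (- set js) = 1"
    using assms distinct_card[OF assms(2)] by (simp add: card_Diff_subset Compl_eq_Diff_UNIV Suc_leI)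
  then obtain i where "- set js = {i}" by (auto simp: card_1_singleton_iff)
  then have "set js = UNIV - {i}" by auto
  then show ?thesis by (rule that)
qed

text \<open>The order of the list is arbitrary; the signs it causes cancel in \<open>flux_vector\<close>.\<close>

definition others :: "'n::finite \<Rightarrow> 'n list" where
  "others i = (SOME js. distinct js \<and> set js = UNIV - {i})"

lemma others:
  fixes i :: "'n::finite"
  shows "distinct (others i)" "set (others i) = UNIV - {i}" "length (others i) = CARD('n) - 1"
proof -
  have "\<exists>js. distinct js \<and> set js = UNIV - {i}"
    using finite_distinct_list[of "UNIV - {i}"] by auto
  from someI_ex[OF this] show *: "distinct (others i)" "set (others i) = UNIV - {i}"
    by (simp_all add: others_def)
  show "length (others i) = CARD('n) - 1"
    using distinct_card[OF *(1)] *(2) by simp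
qed

lemma list_det_others_nonzero:
  fixes i :: "'n::{finite,linorder}"
  shows "list_det (axis i 1 # map (\<lambda>j. axis j 1) (others i)) \<noteq> 0"
proof -
  have "(list_det (map (\<lambda>j. axis j 1) (i # others i)))\<^sup>2 = 1"
    by (rule list_det_distinct_axes) (simp_all add: others)
  then show ?thesis by force
qed

text \<open>
  The vector \<open>b\<close> with \<open>\<omega> = det(b, \<cdot>, \<dots>, \<cdot>)\<close>. Its \<open>i\<close>-th component is read off from the value of \<open>\<omega>\<close> on
  the other coordinate directions. The explicit formula shows that \<open>b\<close> depends smoothly on \<open>\<omega>\<close>.
\<close>

definition flux_vector :: "('n::{finite,linorder} rvec list \<Rightarrow> real) \<Rightarrow> 'n rvec" where
  "flux_vector \<omega> = (\<chi> i. \<omega> (map (\<lambda>j. axis j 1) (others i)) /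
    list_det (axis i 1 # map (\<lambda>j. axis j 1) (others i)))"

text \<open>
  Both sides are alternating in \<open>vs\<close>, so it suffices to compare them on lists of distinct coordinate
  vectors. Such a list misses exactly one index \<open>i\<close> and is therefore a reordering of the one by which
  the component \<open>b\<^sub>i\<close> was defined.
\<close>

lemma list_det_flux_vector:
  fixes \<omega> :: "'n::{finite,linorder} rvec list \<Rightarrow> real"
  assumes "alternating_form (CARD('n) - 1) \<omega>" "length vs = CARD('n) - 1"
  shows "list_det (flux_vector \<omega> # vs) = \<omega> vs"
proof -
  let ?E = "map (\<lambda>j. axis j 1) :: 'n list \<Rightarrow> 'n rvec list"
  define b :: "'n rvec" where
    "b = (\<chi> i. \<omega> (?E (others i)) / list_det (axis i 1 # ?E (others i)))"
  define \<delta> where "\<delta> vs = list_det (b # vs) - \<omega> vs" for vs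
  have alt: "alternating_form (CARD('n) - 1) \<delta>"
    unfolding \<delta>_def using assms(1) alternating_form_list_det
    by (intro alternating_form_diff alternating_form_Cons) auto
  have "\<delta> (?E js) = 0" if len: "length js = CARD('n) - 1" for js
  proof (cases "distinct js")
    case True
    then obtain i where i: "set js = UNIV - {i}" using distinct_missing_one[OF len] by blast
    have *: "\<delta> (?E (others i)) = 0"
      using list_det_Cons_axes[of "others i" i b] others[of i] list_det_others_nonzero[of i]
      by (simp add: \<delta>_def b_def)
    have "mset js = mset (others i)"
      using set_eq_iff_mset_eq_distinct[OF True others(1)[of i]] i others(2)[of i] by simp
    then have "mset (?E js) = mset (?E (others i))" by simp
    from alternating_form_permuted_eq_0[OF alt _ this *] show ?thesis
      using others(3)[of i] by simp
  next
    case False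
    then have "\<not> distinct (?E js)" by (auto simp: distinct_map)
    then show ?thesis using alternating_form_eq_0[OF alt] len by simp
  qed
  then have "(\<Sum>js | length js = CARD('n) - 1. (\<Prod>m<CARD('n) - 1. vs ! m $ (js ! m)) * \<delta> (?E js)) = 0"
    by (intro sum.neutral) simp
  moreover have "\<delta> vs =
      (\<Sum>js | length js = CARD('n) - 1. (\<Prod>m<CARD('n) - 1. vs ! m $ (js ! m)) * \<delta> (?E js))"
    using alternating_form_linear[OF alt] assms(2) by (rule multilinear_expansion)
  ultimately have "list_det (b # vs) = \<omega> vs" unfolding \<delta>_def by linarith
  then show ?thesis by (simp only: b_def flux_vector_def)
qed

lemma list_det_Cons_inj:
  fixes b b' :: "'n::{finite,linorder} rvec"
  assumes "\<And>vs. length vs = CARD('n) - 1 \<Longrightarrow> list_det (b # vs) = list_det (b' # vs)"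
  shows "b = b'"
proof (intro vec_eq_iff[THEN iffD2] allI)
  fix i
  show "b $ i = b' $ i"
    using assms[of "map (\<lambda>j. axis j 1) (others i)"] list_det_others_nonzero[of i]
      list_det_Cons_axes[of "others i" i b] list_det_Cons_axes[of "others i" i b'] others[of i]
    by simp
qed

text \<open>
  Both factors vanish unless \<open>is\<close> lists all indices except one, \<open>i\<close> say, in some order; they are then
  \<open>w\<^sub>i\<close> and \<open>v\<^sub>i\<close> up to a sign, and the product of the two signs comes from moving \<open>v\<close> to the front.
  Each index \<open>i\<close> is omitted by \<open>(n - 1)!\<close> such lists.
\<close>

lemma sum_list_det_list_det:
  fixes w v :: "'n::{finite,linorder} rvec"
  shows "(\<Sum>is | length is = CARD('n) - 1.
      list_det (w # map (\<lambda>i. axis i 1) is) * list_det (map (\<lambda>i. axis i 1) is @ [v])) =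
    (-1) ^ (CARD('n) - 1) * fact (CARD('n) - 1) * (w \<bullet> v)"
proof -
  let ?E = "map (\<lambda>j. axis j 1) :: 'n list \<Rightarrow> 'n rvec list" and ?N = "CARD('n) - 1"
  define P where "P i = {is. length is = ?N \<and> distinct is \<and> set is \<subseteq> UNIV - {i :: 'n}}" for i
  have set: "set is = UNIV - {i}" if "is \<in> P i" for i "is"
  proof (rule card_subset_eq)
    show "card (set is) = card (UNIV - {i})"
      using that by (simp add: P_def distinct_card card_Diff_singleton)
  qed (use that in \<open>auto simp: P_def\<close>)
  have fin: "finite {is :: 'n list. length is = ?N}"
    using finite_lists_length_eq[of "UNIV :: 'n set" ?N] by simp
  then have finP: "finite (P i)" for i by (rule finite_subset[rotated]) (auto simp: P_def)
  have card: "card (P i) = fact ?N" for i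
    using card_lists_distinct_length_eq[of "UNIV - {i}" ?N] by (simp add: P_def fact_prod)
  have last: "list_det (?E is @ [v]) = (-1) ^ ?N * list_det (v # ?E is)" if "length is = ?N" for "is"
  proof -
    have "length (?E is) + Suc (length ([] :: 'n rvec list)) = CARD('n)" using that by simp
    from alternating_form_move[OF alternating_form_list_det this, of v] show ?thesis
      unfolding append_Nil2 length_map that .
  qed
  have "(\<Sum>is | length is = ?N. list_det (w # ?E is) * list_det (?E is @ [v])) =
      (\<Sum>is\<in>(\<Union>i. P i). list_det (w # ?E is) * list_det (?E is @ [v]))"
  proof (intro sum.mono_neutral_right ballI fin)
    fix "is" assume *: "is \<in> {is. length is = ?N} - (\<Union>i. P i)"
    have "\<not> distinct is"
    proof
      assume dist: "distinct is"
      have len: "length is = ?N" using * by simp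
      obtain i where "set is = UNIV - {i}" using distinct_missing_one[OF len dist] .
      then have "is \<in> P i" using dist len by (simp add: P_def)
      then show False using * by blast
    qed
    then have "\<not> distinct (w # ?E is)" by (auto simp: distinct_map)
    then show "list_det (w # ?E is) * list_det (?E is @ [v]) = 0"
      using alternating_form_eq_0[OF alternating_form_list_det, of "w # ?E is"] * by simp
  qed (auto simp: P_def)
  also have "\<dots> = (\<Sum>i\<in>UNIV. \<Sum>is\<in>P i. list_det (w # ?E is) * list_det (?E is @ [v]))"
  proof (intro sum.UNION_disjoint ballI impI)
    show "P i \<inter> P j = {}" if "i \<noteq> j" for i j
    proof -
      have "i = j" if "is \<in> P i" "is \<in> P j" for "is"
        using set[OF that(1)] set[OF that(2)] by blast
      then show ?thesis using \<open>i \<noteq> j\<close> by blast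
    qed
  qed (simp_all add: finP)
  also have "\<dots> = (\<Sum>i\<in>UNIV. \<Sum>is\<in>P i. (-1) ^ ?N * (w $ i * v $ i))"
  proof (intro sum.cong refl)
    fix i "is" assume "is": "is \<in> P i"
    have "(list_det (?E (i # is)))\<^sup>2 = 1"
      using "is" by (intro list_det_distinct_axes) (auto simp: P_def)
    then have "list_det (axis i 1 # ?E is) * list_det (axis i 1 # ?E is) = 1"
      by (simp add: power2_eq_square)
    then show "list_det (w # ?E is) * list_det (?E is @ [v]) = (-1) ^ ?N * (w $ i * v $ i)"
      using "is" set[OF "is"] last[of "is"] list_det_Cons_axes[of "is" i w] list_det_Cons_axes[of "is" i v]
      by (simp add: P_def)
  qed
  also have "\<dots> = (-1) ^ ?N * fact ?N * (w \<bullet> v)"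
    using card by (simp add: inner_vec_def sum_distrib_left mult_ac)
  finally show ?thesis .
qed

section \<open>Positive definite matrices\<close>

text \<open>
  The matrices \<open>(1 - t) I + t G\<close> stay positive definite, hence invertible, along the segment from the
  identity to \<open>G\<close>, so the determinant cannot change sign.
\<close>

lemma det_pos_if_positive_definite:
  fixes G :: "'n::finite rmat"
  assumes "\<And>v. v \<noteq> 0 \<Longrightarrow> v \<bullet> (G *v v) > 0"
  shows "det G > 0"
proof -
  define f where "f t = det ((1 - t) *\<^sub>R mat 1 + t *\<^sub>R G)" for t :: real
  have nz: "f t \<noteq> 0" if t: "0 \<le> t" "t \<le> 1" for t
  proof -
    have "v = 0" if "((1 - t) *\<^sub>R mat 1 + t *\<^sub>R G) *v v = 0" for v
    proof (rule ccontr)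
      assume v: "v \<noteq> 0"
      have "0 < (1 - t) * (v \<bullet> v) + t * (v \<bullet> (G *v v))"
      proof (cases "t = 0")
        case False
        then have "0 < t * (v \<bullet> (G *v v))" using t assms[OF v] by simp
        then show ?thesis using t inner_ge_zero[of v] by (simp add: add_nonneg_pos)
      qed (use v in simp)
      also have "\<dots> = v \<bullet> (((1 - t) *\<^sub>R mat 1 + t *\<^sub>R G) *v v)"
        by (simp add: matrix_vector_mult_add_rdistrib inner_add_right flip: scaleR_matrix_vector_assoc)
      finally show False using that by simp
    qed
    then have "inj ((*v) ((1 - t) *\<^sub>R mat 1 + t *\<^sub>R G))"
      by (simp add: linear_injective_0)
    then show ?thesis
      unfolding f_def invertible_det_nz[symmetric] invertible_left_inverse
        matrix_left_invertible_injective .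
  qed
  have "continuous_on {0..1} f"
    unfolding f_def det_def by (intro continuous_intros)
  then have "f 1 > 0"
    using IVT2'[of f 1 0 0] nz by (force simp: f_def)
  then show ?thesis by (simp add: f_def)
qed

lemma matrix_inv_right_left:
  assumes "invertible (G :: 'n::finite rmat)"
  shows "G ** matrix_inv G = mat 1" "matrix_inv G ** G = mat 1"
proof -
  have "\<exists>A. G ** A = mat 1 \<and> A ** G = mat 1" using assms by (simp add: invertible_def)
  from someI_ex[OF this] show "G ** matrix_inv G = mat 1" "matrix_inv G ** G = mat 1"
    by (simp_all add: matrix_inv_def)
qed


lemma list_det_Cons_scaleR:
  fixes b :: "'n::{finite,linorder} rvec"
  assumes "length vs = CARD('n) - 1"
  shows "list_det ((r *\<^sub>R b) # vs) = r * list_det (b # vs)"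
proof -
  have "length (b # vs) = CARD('n)" using assms by simp
  from alternating_form_linear[OF alternating_form_list_det this, of 0] show ?thesis
    using linear_scale[where f = "\<lambda>v. list_det (v # vs)"] by simp
qed

section \<open>Pointwise algebra of metric and flux form\<close>

locale positive_definite =
  fixes G :: "'n::{finite,linorder} rmat"
  assumes symmetric: "transpose G = G"
    and positive: "v \<noteq> 0 \<Longrightarrow> v \<bullet> (G *v v) > 0"
begin

lemma det_pos: "det G > 0"
  using det_pos_if_positive_definite positive by blast

lemma inv: "invertible G"
  using det_pos by (simp add: invertible_det_nz)

lemma inverse_left: "matrix_inv G *v (G *v v) = v"
  by (simp add: matrix_vector_mul_assoc matrix_inv_right_left[OF inv])

lemma inverse_right: "G *v (matrix_inv G *v v) = v"
  by (simp add: matrix_vector_mul_assoc matrix_inv_right_left[OF inv])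

lemma inner_symmetric: "v \<bullet> (G *v w) = w \<bullet> (G *v v)"
  by (metis dot_lmul_matrix inner_commute symmetric transpose_matrix_vector)

lemma inverse_symmetric: "matrix_inv G $ i $ j = matrix_inv G $ j $ i"
proof -
  have "axis j 1 \<bullet> (matrix_inv G *v axis i 1) = axis i 1 \<bullet> (matrix_inv G *v axis j 1)"
    using inner_symmetric[of "matrix_inv G *v axis i 1" "matrix_inv G *v axis j 1"]
    by (simp add: inverse_right inner_commute)
  then show ?thesis
    by (simp add: inner_axis' matrix_vector_mult_basis column_def)
qed

lemma inverse_row: "matrix_inv G $ i = matrix_inv G *v axis i 1"
  using inverse_symmetric by (simp add: matrix_vector_mult_basis column_def vec_eq_iff)

lemma det_inverse: "det (matrix_inv G) = 1 / det G"
proof -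
  have "det (matrix_inv G) * det G = 1"
    using matrix_inv_right_left(2)[OF inv] by (metis det_I det_mul)
  then show ?thesis using det_pos by (simp add: field_simps)
qed

end

lemma flux_field_eqI:
  fixes b :: "'n::{finite,linorder} rvec" and g :: "('a, 'n, 'n rmat) field"
  assumes "det (g c p) > 0"
    and "\<And>vs. length vs = CARD('n) - 1 \<Longrightarrow> sqrt (det (g c p)) * list_det (b # vs) = \<beta> c p vs"
  shows "flux_field g \<beta> c p = b"
  unfolding flux_field_def interior_product_def volume_form_eq_list_det
proof (rule the_equality)
  fix b' assume b': "\<forall>vs. length vs = CARD('n) - 1 \<longrightarrow>
    sqrt (det (g c p)) * list_det (b' # vs) = \<beta> c p vs"
  show "b' = b"
  proof (rule list_det_Cons_inj)
    fix vs :: "'n rvec list" assume "length vs = CARD('n) - 1"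
    then have "sqrt (det (g c p)) * list_det (b' # vs) = sqrt (det (g c p)) * list_det (b # vs)"
      using b' assms(2) by simp
    then show "list_det (b' # vs) = list_det (b # vs)" using assms(1) by simp
  qed
qed (use assms(2) in blast)

lemma flux_field_eq:
  fixes g :: "('a, 'n::{finite,linorder}, 'n rmat) field"
  assumes "det (g c p) > 0" "alternating_form (CARD('n) - 1) (\<beta> c p)"
  shows "flux_field g \<beta> c p = (1 / sqrt (det (g c p))) *\<^sub>R flux_vector (\<beta> c p)"
  using assms by (intro flux_field_eqI)
    (simp_all add: list_det_Cons_scaleR list_det_flux_vector)

lemma volume_flux_field:
  fixes g :: "('a, 'n::{finite,linorder}, 'n rmat) field"
  assumes "det (g c p) > 0" "alternating_form (CARD('n) - 1) (\<beta> c p)"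
    "length vs = CARD('n) - 1"
  shows "sqrt (det (g c p)) * list_det (flux_field g \<beta> c p # vs) = \<beta> c p vs"
  using assms by (simp add: flux_field_eq list_det_Cons_scaleR list_det_flux_vector)

definition lower :: "('a, 'n::{finite,linorder}, 'n rmat) field \<Rightarrow>
    ('a, 'n, 'n rvec) field \<Rightarrow> ('a, 'n, 'n rvec) field" where
  "lower g B c p = g c p *v B c p"

definition sq_norm :: "('a, 'n::{finite,linorder}, 'n rmat) field \<Rightarrow>
    ('a, 'n, 'n rvec) field \<Rightarrow> ('a, 'n, real) field" where
  "sq_norm g B c p = B c p \<bullet> lower g B c p"

text \<open>
  Raising the indices of \<open>\<beta> = \<surd>(det g) det(B, \<cdot>, \<dots>, \<cdot>)\<close> applies \<open>g\<^sup>-\<^sup>1\<close> to the free arguments. Writing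
  \<open>B = g\<^sup>-\<^sup>1 \<eta>\<close>, the factor \<open>det g\<^sup>-\<^sup>1\<close> comes out of the determinant and cancels the two roots, and what
  is left is \<open>sum_list_det_list_det\<close>.
\<close>

lemma hodge_star_flux:
  fixes g :: "('a, 'n::{finite,linorder}, 'n rmat) field"
  assumes "positive_definite (g c p)" "alternating_form (CARD('n) - 1) (\<beta> c p)"
  shows "hodge_star (CARD('n) - 1) g \<beta> c p [v] =
    (-1) ^ (CARD('n) - 1) * (v \<bullet> lower g (flux_field g \<beta>) c p)"
proof -
  interpret positive_definite "g c p" by fact
  let ?N = "CARD('n) - 1" and ?E = "map (\<lambda>j. axis j 1) :: 'n list \<Rightarrow> 'n rvec list"
  let ?I = "matrix_inv (g c p)" and ?b = "flux_field g \<beta> c p"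
  let ?w = "g c p *v ?b"
  have raise: "(\<Sum>js | length js = ?N. (\<Prod>m<?N. ?I $ (is ! m) $ (js ! m)) * \<beta> c p (?E js)) =
      list_det (?w # ?E is) / sqrt (det (g c p))" if len: "length is = ?N" for "is"
  proof -
    have "(\<Sum>js | length js = ?N. (\<Prod>m<?N. ?I $ (is ! m) $ (js ! m)) * \<beta> c p (?E js)) =
        (\<Sum>js | length js = ?N. (\<Prod>m<?N. map (\<lambda>i. ?I $ i) is ! m $ (js ! m)) * \<beta> c p (?E js))"
      using len by (intro sum.cong prod.cong arg_cong2[of _ _ _ _ "(*)"]) auto
    also have "\<dots> = \<beta> c p (map (\<lambda>i. ?I $ i) is)"
      using len alternating_form_linear[OF assms(2)] by (intro multilinear_expansion[symmetric]) auto
    also have "\<dots> = sqrt (det (g c p)) * list_det (?b # map (\<lambda>i. ?I $ i) is)"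
      using volume_flux_field[of g c p \<beta> "map (\<lambda>i. ?I $ i) is", OF det_pos assms(2)] len by simp
    also have "?b # map (\<lambda>i. ?I $ i) is = map ((*v) ?I) (?w # ?E is)"
      by (simp add: inverse_left inverse_row)
    also have "list_det \<dots> = det ?I * list_det (?w # ?E is)"
      using len by (intro list_det_map_matrix) simp
    also have "sqrt (det (g c p)) * \<dots> = list_det (?w # ?E is) / sqrt (det (g c p))"
      using det_pos by (simp add: det_inverse field_simps flip: power2_eq_square)
    finally show ?thesis .
  qed
  have "hodge_star ?N g \<beta> c p [v] = (\<Sum>is | length is = ?N.
      (\<Sum>js | length js = ?N. (\<Prod>m<?N. ?I $ (is ! m) $ (js ! m)) * \<beta> c p (?E js)) *
      (sqrt (det (g c p)) * list_det (?E is @ [v]))) / fact ?N"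
    by (simp only: hodge_star_def volume_form_eq_list_det sum_distrib_right)
  also have "\<dots> = (\<Sum>is | length is = ?N. list_det (?w # ?E is) * list_det (?E is @ [v])) / fact ?N"
  proof (intro arg_cong2[of _ _ _ _ "(/)"] sum.cong refl)
    fix "is" :: "'n list" assume "is \<in> {is. length is = ?N}"
    then have len: "length is = ?N" by simp
    show "(\<Sum>js | length js = ?N. (\<Prod>m<?N. ?I $ (is ! m) $ (js ! m)) * \<beta> c p (?E js)) *
        (sqrt (det (g c p)) * list_det (?E is @ [v])) = list_det (?w # ?E is) * list_det (?E is @ [v])"
      unfolding raise[OF len] using det_pos by simp
  qed
  also have "\<dots> = (-1) ^ ?N * (?w \<bullet> v)"
    unfolding sum_list_det_list_det by simp
  finally show ?thesis by (simp add: lower_def inner_commute)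
qed

text \<open>
  The Christoffel term of \<open>g(\<nabla>\<^sub>b b, v)\<close>, with \<open>G'\<close> the derivative of the matrix of the metric: by
  symmetry the first two summands agree when both are contracted with \<open>b\<close>.
\<close>

lemma christoffel_contraction:
  fixes G' :: "'n::{finite,linorder} rvec \<Rightarrow> 'n rmat" and b v :: "'n rvec"
  assumes "linear G'" "\<And>v. transpose (G' v) = G' v"
  shows "v \<bullet> (\<chi> l. 1/2 * (\<Sum>i\<in>UNIV. \<Sum>j\<in>UNIV. (G' (axis i 1) $ j $ l + G' (axis j 1) $ i $ l -
      G' (axis l 1) $ i $ j) * b $ i * b $ j)) = v \<bullet> (G' b *v b) - 1/2 * (b \<bullet> (G' v *v b))"
proof -
  have sym: "G' x $ i $ j = G' x $ j $ i" for x i j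
    using assms(2)[of x] by (metis transpose_def vec_lambda_beta)
  have lin: "linear (\<lambda>x. G' x $ i $ j)" for i j
    using assms(1) by (intro linearI) (simp_all add: linear_add linear_scale)
  have exp: "G' x $ i $ j = (\<Sum>k\<in>UNIV. x $ k * G' (axis k 1) $ i $ j)" for x i j
    by (rule linear_expansion[OF lin])
  have first: "(\<Sum>i\<in>UNIV. \<Sum>j\<in>UNIV. G' (axis i 1) $ j $ l * b $ i * b $ j) = (G' b *v b) $ l" for l
  proof -
    have "(\<Sum>i\<in>UNIV. \<Sum>j\<in>UNIV. G' (axis i 1) $ j $ l * b $ i * b $ j) =
        (\<Sum>j\<in>UNIV. (\<Sum>i\<in>UNIV. b $ i * G' (axis i 1) $ j $ l) * b $ j)"
      by (subst sum.swap) (simp add: sum_distrib_left sum_distrib_right mult_ac)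
    also have "\<dots> = (\<Sum>j\<in>UNIV. G' b $ l $ j * b $ j)"
      unfolding exp[symmetric] by (simp add: sym[of b _ l])
    finally show ?thesis by (simp add: matrix_vector_mult_def)
  qed
  have second: "(\<Sum>i\<in>UNIV. \<Sum>j\<in>UNIV. G' (axis j 1) $ i $ l * b $ i * b $ j) = (G' b *v b) $ l" for l
    unfolding first[symmetric] by (subst sum.swap) (simp add: mult_ac)
  have third: "(\<Sum>i\<in>UNIV. \<Sum>j\<in>UNIV. G' x $ i $ j * b $ i * b $ j) = b \<bullet> (G' x *v b)" for x
    by (simp add: inner_vec_def matrix_vector_mult_def sum_distrib_left mult_ac)
  have "linear (\<lambda>x. b \<bullet> (G' x *v b))"
    using assms(1) by (intro linearI)
      (simp_all add: linear_add linear_scale matrix_vector_mult_add_rdistrib inner_add_right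
        flip: scaleR_matrix_vector_assoc)
  then have "b \<bullet> (G' v *v b) = (\<Sum>l\<in>UNIV. v $ l * (b \<bullet> (G' (axis l 1) *v b)))"
    by (rule linear_expansion)
  moreover have "(\<Sum>i\<in>UNIV. \<Sum>j\<in>UNIV. (G' (axis i 1) $ j $ l + G' (axis j 1) $ i $ l -
      G' (axis l 1) $ i $ j) * b $ i * b $ j) = 2 * (G' b *v b) $ l - b \<bullet> (G' (axis l 1) *v b)" for l
    using first[of l] second[of l] third[of "axis l 1"]
    by (simp add: algebra_simps sum.distrib sum_subtractf)
  ultimately show ?thesis
    by (simp add: inner_vec_def[of v] right_diff_distrib sum_subtractf sum_distrib_left mult_ac)
qed

section \<open>Charts of an oriented manifold\<close>

text \<open>
  The equation \<open>\<iota>\<^sub>B d\<alpha> = 0\<close> at \<open>p\<close>, for a 1-form \<open>\<alpha>\<close> given by its vector of components, as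
  \<open>d\<alpha>(B, v) = (D\<alpha>(B))(v) - (D\<alpha>(v))(B)\<close> for a constant vector \<open>v\<close> and \<open>B\<close> frozen at \<open>p\<close>.
\<close>

definition contracted_curl_zero :: "('a, 'n::{finite,linorder}, 'n rvec) field \<Rightarrow>
    ('a, 'n, 'n rvec) field \<Rightarrow> ('a, 'n) chart \<Rightarrow> 'a \<Rightarrow> bool" where
  "contracted_curl_zero B \<alpha> c p \<longleftrightarrow>
     (\<forall>v. v \<bullet> D (loc \<alpha> c) (snd c p) (B c p) = B c p \<bullet> D (loc \<alpha> c) (snd c p) v)"

locale oriented_atlas =
  fixes X :: "'a topology" and A :: "('a, 'n::{finite,linorder}) chart set"
  assumes manifold: "oriented_manifold X A"
begin

lemma chart: "c \<in> A \<Longrightarrow> is_chart X c"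
  using manifold by (simp add: oriented_manifold_def)

lemma openin_image: "c \<in> A \<Longrightarrow> openin (top_of_set half_space) (snd c ` fst c)"
  using chart by (simp add: is_chart_def)

lemma inj_on_chart: "c \<in> A \<Longrightarrow> inj_on (snd c) (fst c)"
  using chart[of c] homeomorphic_imp_injective_map[of "subtopology X (fst c)"]
  by (auto simp: is_chart_def topspace_subtopology openin_subset Int_absorb1)

lemma chart_inv: "c \<in> A \<Longrightarrow> p \<in> fst c \<Longrightarrow> chart_inv c (snd c p) = p"
  by (simp add: chart_inv_def inj_on_chart inv_into_f_f)

lemma loc_eq: "c \<in> A \<Longrightarrow> p \<in> fst c \<Longrightarrow> loc T c (snd c p) = T c p"
  by (simp add: loc_def chart_inv)

lemma openin_overlap:
  assumes "c \<in> A" "d \<in> A"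
  shows "openin (top_of_set half_space) (snd c ` (fst c \<inter> fst d))"
proof -
  have "openin (subtopology X (fst c)) (fst c \<inter> fst d)"
    using chart[OF assms(2)] by (auto simp: is_chart_def openin_subtopology)
  then have "openin (top_of_set (snd c ` fst c)) (snd c ` (fst c \<inter> fst d))"
    using chart[OF assms(1)] homeomorphic_imp_open_map unfolding is_chart_def open_map_def by blast
  then show ?thesis using openin_image[OF assms(1)] openin_trans by blast
qed

lemma transition_has_derivative:
  assumes "c \<in> A" "d \<in> A" "p \<in> fst c \<inter> fst d"
  shows "(transition c d has_derivative jac c d p) (at (snd c p) within half_space)"
  unfolding jac_def using manifold assms openin_overlap
  by (intro smooth_on_has_derivative_D[of "snd c ` (fst c \<inter> fst d)"])
    (auto simp: oriented_manifold_def)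

lemma jac_linear:
  assumes "c \<in> A" "d \<in> A" "p \<in> fst c \<inter> fst d"
  shows "jac c d p = (*v) (matrix (jac c d p))" "det (matrix (jac c d p)) > 0"
  using transition_has_derivative[OF assms, THEN has_derivative_linear] manifold assms
  by (auto simp: matrix_works oriented_manifold_def fun_eq_iff)

text \<open>
  This is the chain rule for \<open>loc f c = loc f d \<circ> transition c d\<close>. The overlap is relatively open in
  the half-space, so derivatives within either set agree, also at boundary points.
\<close>

lemma D_scalar_transform:
  fixes f :: "('a, 'n, real) field"
  assumes "c \<in> A" "d \<in> A" "p \<in> fst c \<inter> fst d"
    and inv: "\<And>q. q \<in> fst c \<inter> fst d \<Longrightarrow> f c q = f d q"
    and "smooth_on (snd d ` fst d) (loc f d)"
  shows "D (loc f c) (snd c p) v = D (loc f d) (snd d p) (jac c d p v)"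
proof -
  let ?O = "snd c ` (fst c \<inter> fst d)" and ?x = "snd c p" and ?t = "transition c d"
  have x: "?x \<in> ?O" and "?x \<in> half_space"
    using assms(3) openin_overlap[OF assms(1,2)] openin_imp_subset by blast+
  have sub: "?O \<subseteq> half_space" using openin_overlap[OF assms(1,2)] openin_imp_subset by blast
  have tx: "?t (snd c q) = snd d q" if "q \<in> fst c \<inter> fst d" for q
    using that assms(1) by (simp add: transition_def chart_inv)
  have "?t ` ?O \<subseteq> half_space"
    using tx openin_image[OF assms(2)] openin_imp_subset by fastforce
  moreover have "(loc f d has_derivative D (loc f d) (?t ?x)) (at (?t ?x) within half_space)"
    using assms tx openin_image[OF assms(2)]
    by (intro smooth_on_has_derivative_D[of "snd d ` fst d"]) auto
  ultimately have "(loc f d \<circ> ?t has_derivative D (loc f d) (?t ?x) \<circ> jac c d p) (at ?x within ?O)"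
    using has_derivative_subset[OF transition_has_derivative[OF assms(1-3)] sub]
    by (intro diff_chain_within) (auto intro: has_derivative_subset)
  moreover obtain U where "open U" "?O = half_space \<inter> U"
    using openin_overlap[OF assms(1,2)] by (auto simp: openin_open)
  then have "at ?x within ?O = at ?x within half_space"
    using x by (intro at_within_nhd[of _ U]) auto
  ultimately have "(loc f d \<circ> ?t has_derivative D (loc f d) (?t ?x) \<circ> jac c d p)
      (at ?x within half_space)" by simp
  then have "(loc f c has_derivative D (loc f d) (?t ?x) \<circ> jac c d p) (at ?x within half_space)"
  proof (rule has_derivative_cong_rel_open[OF openin_overlap[OF assms(1,2)] x, rotated])
    fix y assume "y \<in> ?O"
    then show "(loc f d \<circ> ?t) y = loc f c y"
      using tx inv assms(1,2) by (auto simp: loc_eq)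
  qed
  from D_eqI[OF \<open>?x \<in> half_space\<close> this] show ?thesis
    unfolding tx[OF assms(3)] by (simp only: comp_apply)
qed

text \<open>
  Turns a field of scalars whose representatives agree on overlaps into a function on the manifold,
  by evaluating in an arbitrary chart around each point.
\<close>

definition patch :: "('a, 'n, 'b) field \<Rightarrow> 'a \<Rightarrow> 'b" where
  "patch f p = f (SOME c. c \<in> A \<and> p \<in> fst c) p"

lemma patch_eq:
  assumes "\<And>c d p. c \<in> A \<Longrightarrow> d \<in> A \<Longrightarrow> p \<in> fst c \<inter> fst d \<Longrightarrow> f c p = f d p"
    and "c \<in> A" "p \<in> fst c"
  shows "patch f p = f c p"
proof -
  let ?d = "SOME c. c \<in> A \<and> p \<in> fst c"
  have "\<exists>c. c \<in> A \<and> p \<in> fst c" using assms(2,3) by blast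
  then have "?d \<in> A \<and> p \<in> fst ?d" by (rule someI_ex)
  then show ?thesis using assms(1)[of ?d c p] assms(2,3) by (simp add: patch_def)
qed

lemma smooth_function_patch:
  assumes "\<And>c d p. c \<in> A \<Longrightarrow> d \<in> A \<Longrightarrow> p \<in> fst c \<inter> fst d \<Longrightarrow> f c p = f d p"
    and "\<And>c. c \<in> A \<Longrightarrow> smooth_on (snd c ` fst c) (loc f c)"
  shows "smooth_function A (patch f)"
  unfolding smooth_function_def
proof
  fix c assume c: "c \<in> A"
  show "smooth_on (snd c ` fst c) (patch f \<circ> chart_inv c)"
  proof (rule smooth_on_cong[OF assms(2)[OF c]])
    fix x assume "x \<in> snd c ` fst c"
    then obtain p where p: "p \<in> fst c" "x = snd c p" by blast
    then show "loc f c x = (patch f \<circ> chart_inv c) x"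
      using patch_eq[OF assms(1) c p(1)] c by (simp add: loc_eq chart_inv)
  qed
qed

lemma smooth_on_cong_loc:
  assumes "c \<in> A" "smooth_on (snd c ` fst c) F" "\<And>p. p \<in> fst c \<Longrightarrow> T c p = F (snd c p)"
  shows "smooth_on (snd c ` fst c) (loc T c)"
  using assms(1,3) by (intro smooth_on_cong[OF assms(2)]) (auto simp: loc_eq)

text \<open>
  The condition only depends on \<open>\<alpha>\<close> through its values on the chart domain, and it is insensitive to
  rescaling \<open>B\<close>. This is what makes it comparable between conformal metrics.
\<close>

lemma contracted_curl_zero_cong:
  assumes "c \<in> A" "p \<in> fst c" "\<And>q. q \<in> fst c \<Longrightarrow> \<alpha> c q = \<alpha>' c q"
    and "smooth_on (snd c ` fst c) (loc \<alpha> c)"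
    and "r \<noteq> 0" "B' c p = r *\<^sub>R B c p"
  shows "contracted_curl_zero B \<alpha> c p \<longleftrightarrow> contracted_curl_zero B' \<alpha>' c p"
proof -
  have x: "snd c p \<in> snd c ` fst c" using assms(2) by blast
  have "D (loc \<alpha> c) (snd c p) = D (loc \<alpha>' c) (snd c p)"
    using assms(1,3) by (intro D_cong[OF openin_image[OF assms(1)] x]) (auto simp: loc_eq)
  moreover have "linear (D (loc \<alpha> c) (snd c p))"
    using smooth_on_has_derivative_D[OF openin_image[OF assms(1)] assms(4) x] has_derivative_linear
    by blast
  ultimately show ?thesis
    using assms(5,6) by (simp add: contracted_curl_zero_def linear_scale)
qed

end


section \<open>Flux forms on a Riemannian manifold\<close>

locale riemannian_flux = oriented_atlas X A
  for X :: "'a topology" and A :: "('a, 'n::{finite,linorder}) chart set" +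
  fixes g :: "('a, 'n, 'n rmat) field" and \<beta> :: "('a, 'n) form"
  assumes metric: "riemannian_metric A g"
    and form: "differential_form A (CARD('n) - 1) \<beta>"
    and nonzero: "nowhere_vanishing A (CARD('n) - 1) \<beta>"
begin

abbreviation "B \<equiv> flux_field g \<beta>"
abbreviation "\<eta> \<equiv> lower g B"
abbreviation "N \<equiv> sq_norm g B"

lemma positive_definite: "c \<in> A \<Longrightarrow> p \<in> fst c \<Longrightarrow> positive_definite (g c p)"
  using metric unfolding riemannian_metric_def positive_definite_def by blast

lemma det_pos: "c \<in> A \<Longrightarrow> p \<in> fst c \<Longrightarrow> det (g c p) > 0"
  using positive_definite positive_definite.det_pos by blast

lemma alternating: "c \<in> A \<Longrightarrow> p \<in> fst c \<Longrightarrow> alternating_form (CARD('n) - 1) (\<beta> c p)"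
  using form by (simp add: differential_form_def)

lemma B_nonzero:
  assumes "c \<in> A" "p \<in> fst c"
  shows "B c p \<noteq> 0"
proof
  assume "B c p = 0"
  then have B0: "B c p = 0 *\<^sub>R B c p" by simp
  have "\<beta> c p vs = 0" if "length vs = CARD('n) - 1" for vs
    using volume_flux_field[where g = g and c = c and p = p and \<beta> = \<beta>,
        OF det_pos[OF assms] alternating[OF assms] that]
      list_det_Cons_scaleR[OF that, of 0 "B c p"] B0 by simp
  then show False using nonzero assms unfolding nowhere_vanishing_def by metis
qed

lemma N_pos: "c \<in> A \<Longrightarrow> p \<in> fst c \<Longrightarrow> N c p > 0"
  using positive_definite.positive[OF positive_definite B_nonzero]
  by (simp add: sq_norm_def lower_def)

lemma smooth_g: "c \<in> A \<Longrightarrow> smooth_on (snd c ` fst c) (loc g c)"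
  using metric by (simp add: riemannian_metric_def)

lemma smooth_B:
  assumes c: "c \<in> A"
  shows "smooth_on (snd c ` fst c) (loc B c)"
proof (rule smooth_on_cong_loc[OF c])
  have \<beta>: "smooth_on (snd c ` fst c) (\<lambda>x. loc \<beta> c x (map (\<lambda>j. axis j 1) (others i)))" for i
    using form c by (simp add: differential_form_def others)
  have "smooth_on (snd c ` fst c) (\<lambda>x. inverse (sqrt (det (loc g c x))))"
    using det_pos[OF c] less_imp_neq[OF det_pos[OF c]]
    by (intro smooth_on_inverse smooth_on_sqrt smooth_on_det smooth_g c) (auto simp: loc_eq c)
  then show "smooth_on (snd c ` fst c)
      (\<lambda>x. inverse (sqrt (det (loc g c x))) *\<^sub>R flux_vector (loc \<beta> c x))"
    unfolding flux_vector_def divide_inverse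
    by (intro smooth_on_scaleR smooth_on_vec) (simp add: smooth_on_mult \<beta> smooth_on_const)
  show "B c p = inverse (sqrt (det (loc g c (snd c p)))) *\<^sub>R flux_vector (loc \<beta> c (snd c p))"
    if "p \<in> fst c" for p
    using flux_field_eq[where g = g and c = c and p = p and \<beta> = \<beta>,
        OF det_pos[OF c that] alternating[OF c that]] c that
    by (simp add: loc_eq divide_inverse)
qed

lemma smooth_\<eta>: "c \<in> A \<Longrightarrow> smooth_on (snd c ` fst c) (loc \<eta> c)"
  by (rule smooth_on_cong_loc[OF _ smooth_on_bilinear[OF bounded_bilinear_matrix_vector_mult
          smooth_g smooth_B]])
    (auto simp: lower_def loc_eq)

lemma smooth_N: "c \<in> A \<Longrightarrow> smooth_on (snd c ` fst c) (loc N c)"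
  by (rule smooth_on_cong_loc[OF _ smooth_on_bilinear[OF bounded_bilinear_inner smooth_B smooth_\<eta>]])
    (auto simp: sq_norm_def loc_eq)

text \<open>
  By uniqueness of the flux field it suffices that the pushed forward vector contracts the volume form
  in \<open>d\<close> to \<open>\<beta>\<close>. The determinant of the Jacobian produced by the change of frame is the one relating
  \<open>\<surd>(det g)\<close> in the two charts; here its positivity, that is the orientation, enters.
\<close>

lemma B_transform:
  assumes "c \<in> A" "d \<in> A" "p \<in> fst c \<inter> fst d"
  shows "B d p = jac c d p (B c p)"
proof -
  have p: "p \<in> fst c" "p \<in> fst d" using assms(3) by auto
  let ?J = "matrix (jac c d p)"
  note J = jac_linear[OF assms]
  obtain K where K: "?J ** K = mat 1"
    using J(2) by (metis invertible_det_nz invertible_right_inverse less_irrefl)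
  have "v \<bullet> (g c p *v w) = v \<bullet> ((transpose ?J ** g d p ** ?J) *v w)" for v w
  proof -
    have "v \<bullet> (g c p *v w) = (?J *v v) \<bullet> (g d p *v (?J *v w))"
      using metric assms J(1) unfolding riemannian_metric_def by metis
    then show ?thesis
      by (metis dot_lmul_matrix inner_commute matrix_vector_mul_assoc transpose_matrix_vector)
  qed
  then have "g c p *v w = (transpose ?J ** g d p ** ?J) *v w" for w
    by (rule vector_eq_ldot[THEN iffD1, OF allI])
  then have "g c p = transpose ?J ** g d p ** ?J" by (simp add: matrix_eq)
  then have det: "sqrt (det (g c p)) = det ?J * sqrt (det (g d p))"
    using J(2) by (simp add: det_mul det_transpose real_sqrt_mult)
  show ?thesis
  proof (rule flux_field_eqI[where g = g and c = d and p = p and \<beta> = \<beta>, OF det_pos[OF assms(2) p(2)]])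
    fix vs :: "'n rvec list" assume len: "length vs = CARD('n) - 1"
    define us where "us = map ((*v) K) vs"
    have "map ((*v) ?J) us = vs"
      unfolding us_def map_map comp_def matrix_vector_mul_assoc K by simp
    then have vs: "vs = map (jac c d p) us" using J(1) by metis
    have "length (B c p # us) = CARD('n)" using len by (simp add: us_def)
    from list_det_map_matrix[OF this, of ?J]
    have "list_det (jac c d p (B c p) # vs) = det ?J * list_det (B c p # us)"
      by (simp only: list.map vs[symmetric] J(1)[symmetric])
    then have "sqrt (det (g d p)) * list_det (jac c d p (B c p) # vs) =
        sqrt (det (g c p)) * list_det (B c p # us)" by (simp add: det)
    also have "\<dots> = \<beta> c p us"
      using volume_flux_field[where g = g and c = c and p = p and \<beta> = \<beta>,
          OF det_pos[OF assms(1) p(1)] alternating[OF assms(1) p(1)]] len by (simp add: us_def)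
    also have "\<dots> = \<beta> d p (map (jac c d p) us)"
    proof -
      have "length us = CARD('n) - 1" using len by (simp add: us_def)
      then show ?thesis using form assms unfolding differential_form_def by blast
    qed
    also have "\<dots> = \<beta> d p vs" by (simp only: vs[symmetric])
    finally show "sqrt (det (g d p)) * list_det (jac c d p (B c p) # vs) = \<beta> d p vs" .
  qed
qed

lemma N_invariant:
  assumes "c \<in> A" "d \<in> A" "p \<in> fst c \<inter> fst d"
  shows "N c p = N d p"
  unfolding sq_norm_def lower_def B_transform[OF assms]
  using metric assms unfolding riemannian_metric_def by blast

lemma force_free_iff:
  "force_free A g \<beta> \<longleftrightarrow> (\<forall>c\<in>A. \<forall>p\<in>fst c. contracted_curl_zero B \<eta> c p)"
proof -
  have "(\<forall>vs. length vs = 1 \<longrightarrow>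
      interior_product B (ext_deriv (hodge_star (CARD('n) - 1) g \<beta>)) c p vs = 0) \<longleftrightarrow>
      contracted_curl_zero B \<eta> c p" if c: "c \<in> A" and p: "p \<in> fst c" for c p
  proof -
    let ?s = "(-1) ^ (CARD('n) - 1) :: real" and ?x = "snd c p"
    let ?\<eta>' = "D (loc \<eta> c) ?x"
    have x: "?x \<in> snd c ` fst c" "?x \<in> half_space"
      using p openin_image[OF c] openin_imp_subset by blast+
    have "D (\<lambda>x. loc (hodge_star (CARD('n) - 1) g \<beta>) c x [v]) ?x = (\<lambda>w. ?s * (v \<bullet> ?\<eta>' w))" for v
    proof -
      have "D (\<lambda>x. loc (hodge_star (CARD('n) - 1) g \<beta>) c x [v]) ?x = D (\<lambda>x. ?s * (v \<bullet> loc \<eta> c x)) ?x"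
      proof (rule D_cong[OF openin_image[OF c] x(1)])
        fix y assume "y \<in> snd c ` fst c"
        then obtain q where q: "q \<in> fst c" "y = snd c q" by blast
        show "loc (hodge_star (CARD('n) - 1) g \<beta>) c y [v] = ?s * (v \<bullet> loc \<eta> c y)"
          using hodge_star_flux[where g = g and c = c and p = q and \<beta> = \<beta> and v = v,
              OF positive_definite[OF c q(1)] alternating[OF c q(1)]] c q
          by (simp add: loc_eq)
      qed
      also have "\<dots> = (\<lambda>w. ?s * (v \<bullet> ?\<eta>' w))"
        by (intro D_eqI x has_derivative_mult_right has_derivative_inner_right
            smooth_on_has_derivative_D[OF openin_image[OF c] smooth_\<eta>[OF c] x(1)])
      finally show ?thesis .
    qed
    then have "interior_product B (ext_deriv (hodge_star (CARD('n) - 1) g \<beta>)) c p [v] =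
        ?s * (v \<bullet> ?\<eta>' (B c p) - B c p \<bullet> ?\<eta>' v)" for v
      by (simp add: interior_product_def ext_deriv_def numeral_2_eq_2 algebra_simps)
    then show ?thesis
      by (auto simp: contracted_curl_zero_def length_Suc_conv)
  qed
  then show ?thesis by (simp add: force_free_def)
qed

text \<open>
  The identity \<open>g(\<nabla>\<^sub>B B, v) = d\<eta>(B, v) + dN(v)/2\<close>. Expanding \<open>D\<eta>\<close> and \<open>DN\<close> by the product rule, the
  derivatives of \<open>B\<close> in direction \<open>v\<close> cancel by symmetry of \<open>g\<close>, and those of \<open>g\<close> combine to the
  Christoffel term.
\<close>

lemma cov_deriv_flux:
  assumes c: "c \<in> A" and p: "p \<in> fst c"
  shows "v \<bullet> (g c p *v cov_deriv g B B c p) =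
    v \<bullet> D (loc \<eta> c) (snd c p) (B c p) - B c p \<bullet> D (loc \<eta> c) (snd c p) v +
    1/2 * D (loc N c) (snd c p) v"
proof -
  interpret G: positive_definite "g c p" by (rule positive_definite[OF c p])
  let ?x = "snd c p" and ?b = "B c p"
  let ?G' = "D (loc g c) ?x" and ?b' = "D (loc B c) ?x"
  have x: "?x \<in> snd c ` fst c" "?x \<in> half_space"
    using p openin_image[OF c] openin_imp_subset by blast+
  note der = smooth_on_has_derivative_D[OF openin_image[OF c] _ x(1)]
  note G' = der[OF smooth_g[OF c]] and b' = der[OF smooth_B[OF c]]
  have "((\<lambda>x. loc g c x *v loc B c x) has_derivative
      (\<lambda>h. loc g c ?x *v ?b' h + ?G' h *v loc B c ?x)) (at ?x within half_space)"
    by (rule bounded_bilinear.FDERIV[OF bounded_bilinear_matrix_vector_mult G' b'])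
  then have "(loc \<eta> c has_derivative (\<lambda>h. loc g c ?x *v ?b' h + ?G' h *v loc B c ?x))
      (at ?x within half_space)"
    by (rule has_derivative_cong_rel_open[OF openin_image[OF c] x(1), rotated])
      (use c in \<open>auto simp: loc_eq lower_def\<close>)
  then have \<eta>': "D (loc \<eta> c) ?x = (\<lambda>h. g c p *v ?b' h + ?G' h *v ?b)"
    using D_eqI[OF x(2)] c p by (simp add: loc_eq)
  have "((\<lambda>x. loc B c x \<bullet> loc \<eta> c x) has_derivative
      (\<lambda>h. loc B c ?x \<bullet> D (loc \<eta> c) ?x h + ?b' h \<bullet> loc \<eta> c ?x)) (at ?x within half_space)"
    by (rule has_derivative_inner[OF b' der[OF smooth_\<eta>[OF c]]])
  then have "(loc N c has_derivative
      (\<lambda>h. loc B c ?x \<bullet> D (loc \<eta> c) ?x h + ?b' h \<bullet> loc \<eta> c ?x)) (at ?x within half_space)"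
    by (rule has_derivative_cong_rel_open[OF openin_image[OF c] x(1), rotated])
      (use c in \<open>auto simp: loc_eq sq_norm_def\<close>)
  then have N': "D (loc N c) ?x = (\<lambda>h. ?b \<bullet> D (loc \<eta> c) ?x h + ?b' h \<bullet> (g c p *v ?b))"
    using D_eqI[OF x(2)] c p by (simp add: loc_eq lower_def)
  have "bounded_linear (transpose :: 'n rmat \<Rightarrow> 'n rmat)"
    by (intro linear_conv_bounded_linear[THEN iffD1] linearI) (simp_all add: transpose_def vec_eq_iff)
  then have "((\<lambda>x. transpose (loc g c x)) has_derivative (\<lambda>h. transpose (?G' h)))
      (at ?x within half_space)"
    using G' by (rule bounded_linear.has_derivative)
  then have "(loc g c has_derivative (\<lambda>h. transpose (?G' h))) (at ?x within half_space)"
    by (rule has_derivative_cong_rel_open[OF openin_image[OF c] x(1), rotated])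
      (use c positive_definite.symmetric[OF positive_definite[OF c]] in \<open>auto simp: loc_eq\<close>)
  then have sym: "transpose (?G' h) = ?G' h" for h
    using has_derivative_half_space_unique[OF x(2) _ G'] by metis
  \<comment> \<open>The Christoffel term with its upper index lowered.\<close>
  define q where "q = (\<chi> l. 1/2 * (\<Sum>i\<in>UNIV. \<Sum>j\<in>UNIV. (?G' (axis i 1) $ j $ l +
      ?G' (axis j 1) $ i $ l - ?G' (axis l 1) $ i $ j) * ?b $ i * ?b $ j))"
  have "cov_deriv g B B c p = ?b' ?b + matrix_inv (g c p) *v q"
  proof (intro vec_eq_iff[THEN iffD2] allI)
    fix k
    have lin: "linear (\<lambda>h. ?b' h $ k)"
      using has_derivative_linear[OF b'] by (intro linearI) (simp_all add: linear_add linear_scale)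
    have "(\<Sum>i\<in>UNIV. ?b $ i * partial i B c p $ k) = ?b' ?b $ k"
      unfolding linear_expansion[OF lin, of ?b] by (simp add: partial_def)
    moreover have "(\<Sum>i\<in>UNIV. \<Sum>j\<in>UNIV. christoffel g k i j c p * ?b $ i * ?b $ j) =
        (\<Sum>i\<in>UNIV. \<Sum>j\<in>UNIV. \<Sum>l\<in>UNIV. matrix_inv (g c p) $ k $ l * (1/2 * ((?G' (axis i 1) $ j $ l +
      ?G' (axis j 1) $ i $ l - ?G' (axis l 1) $ i $ j) * ?b $ i * ?b $ j)))"
      by (simp add: christoffel_def partial_def sum_distrib_left sum_distrib_right mult_ac)
    moreover have "\<dots> = (\<Sum>l\<in>UNIV. \<Sum>i\<in>UNIV. \<Sum>j\<in>UNIV. matrix_inv (g c p) $ k $ l * (1/2 * ((?G' (axis i 1) $ j $ l +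
      ?G' (axis j 1) $ i $ l - ?G' (axis l 1) $ i $ j) * ?b $ i * ?b $ j)))"
      by (subst sum.swap[of _ UNIV UNIV], subst (2) sum.swap) (rule refl)
    moreover have "\<dots> = (matrix_inv (g c p) *v q) $ k"
      by (simp add: q_def matrix_vector_mult_def sum_distrib_left)
    ultimately show "cov_deriv g B B c p $ k = (?b' ?b + matrix_inv (g c p) *v q) $ k"
      by (simp add: cov_deriv_def)
  qed
  then have "v \<bullet> (g c p *v cov_deriv g B B c p) = v \<bullet> (g c p *v ?b' ?b) + v \<bullet> q"
    by (simp add: matrix_vector_right_distrib G.inverse_right inner_add_right)
  also have "v \<bullet> q = v \<bullet> (?G' ?b *v ?b) - 1/2 * (?b \<bullet> (?G' v *v ?b))"
    unfolding q_def by (rule christoffel_contraction[OF has_derivative_linear[OF G'] sym])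
  finally show ?thesis
    using G.inner_symmetric[of ?b "?b' v"]
    by (simp add: \<eta>' N' inner_add_right diff_divide_distrib)
qed

text \<open>
  The logarithmic derivative \<open>d(ln \<surd>N)(B)\<close> of the length of \<open>B\<close> along \<open>B\<close>: the only function \<open>\<rho>\<close>
  that can occur in \<open>\<nabla>\<^sub>B B = \<rho> B\<close>.
\<close>

definition stretch :: "('a, 'n, real) field" where
  "stretch c p = D (loc N c) (snd c p) (B c p) / (2 * N c p)"

text \<open>
  Pair the equation with \<open>B\<close>: as \<open>d\<eta>(B, B) = 0\<close>, only \<open>dN(B)/2 = \<rho> N\<close> remains.
\<close>

lemma geodesic_factor:
  assumes c: "c \<in> A" and p: "p \<in> fst c" and "cov_deriv g B B c p = r *\<^sub>R B c p"
  shows "r = stretch c p"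
proof -
  have "r * N c p = 1/2 * D (loc N c) (snd c p) (B c p)"
    using cov_deriv_flux[OF c p, of "B c p"] assms(3)
    by (simp add: sq_norm_def lower_def matrix_vector_mult_scaleR)
  then show ?thesis using N_pos[OF c p] by (simp add: stretch_def field_simps)
qed

abbreviation unit_covector :: "('a, 'n, 'n rvec) field" where
  "unit_covector \<equiv> \<lambda>c p. (1 / sqrt (N c p)) *\<^sub>R \<eta> c p"

lemma smooth_unit_covector:
  assumes c: "c \<in> A"
  shows "smooth_on (snd c ` fst c) (loc unit_covector c)"
proof (rule smooth_on_cong_loc[OF c])
  show "smooth_on (snd c ` fst c) (\<lambda>x. inverse (sqrt (loc N c x)) *\<^sub>R loc \<eta> c x)"
    using N_pos[OF c] less_imp_neq[OF N_pos[OF c]]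
    by (intro smooth_on_scaleR smooth_on_inverse smooth_on_sqrt smooth_N smooth_\<eta> c)
      (auto simp: loc_eq c)
qed (use c in \<open>simp add: loc_eq divide_inverse\<close>)

text \<open>
  The product rule applied to \<open>N\<^sup>-\<^sup>1\<^sup>/\<^sup>2 \<eta>\<close> produces the terms \<open>dN(v)/2\<close> and \<open>- stretch \<cdot> \<eta>(v)\<close> next to
  \<open>d\<eta>(B, v)\<close>; the first of them turns \<open>d\<eta>(B, v)\<close> into \<open>g(\<nabla>\<^sub>B B, v)\<close>.
\<close>

lemma curl_unit_covector:
  assumes c: "c \<in> A" and p: "p \<in> fst c"
  shows "v \<bullet> D (loc unit_covector c) (snd c p) (B c p) -
      B c p \<bullet> D (loc unit_covector c) (snd c p) v =
    (1 / sqrt (N c p)) * (v \<bullet> (g c p *v (cov_deriv g B B c p - stretch c p *\<^sub>R B c p)))"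
proof -
  let ?x = "snd c p" and ?n = "N c p"
  let ?N' = "D (loc N c) ?x" and ?\<eta>' = "D (loc \<eta> c) ?x"
  have n: "?n > 0" by (rule N_pos[OF c p])
  have x: "?x \<in> snd c ` fst c" "?x \<in> half_space"
    using p openin_image[OF c] openin_imp_subset by blast+
  note der = smooth_on_has_derivative_D[OF openin_image[OF c] _ x(1)]
  have "((\<lambda>x. 1 / sqrt (loc N c x)) has_derivative (\<lambda>h. - (?N' h / (2 * ?n * sqrt ?n))))
      (at ?x within half_space)"
    using n c p by (auto intro!: derivative_eq_intros der[OF smooth_N[OF c]] simp: loc_eq field_simps)
  then have "((\<lambda>x. (1 / sqrt (loc N c x)) *\<^sub>R loc \<eta> c x) has_derivative
      (\<lambda>h. (1 / sqrt (loc N c ?x)) *\<^sub>R ?\<eta>' h + (- (?N' h / (2 * ?n * sqrt ?n))) *\<^sub>R loc \<eta> c ?x))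
      (at ?x within half_space)"
    by (rule has_derivative_scaleR[OF _ der[OF smooth_\<eta>[OF c]]])
  then have "(loc unit_covector c has_derivative
      (\<lambda>h. (1 / sqrt (loc N c ?x)) *\<^sub>R ?\<eta>' h + (- (?N' h / (2 * ?n * sqrt ?n))) *\<^sub>R loc \<eta> c ?x))
      (at ?x within half_space)"
    by (rule has_derivative_cong_rel_open[OF openin_image[OF c] x(1), rotated])
      (use c in \<open>auto simp: loc_eq\<close>)
  then have D: "D (loc unit_covector c) ?x =
      (\<lambda>h. (1 / sqrt ?n) *\<^sub>R ?\<eta>' h - (?N' h / (2 * ?n * sqrt ?n)) *\<^sub>R \<eta> c p)"
    using D_eqI[OF x(2)] c p by (simp add: loc_eq)
  have "v \<bullet> D (loc unit_covector c) ?x (B c p) - B c p \<bullet> D (loc unit_covector c) ?x v =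
      (1 / sqrt ?n) * (v \<bullet> ?\<eta>' (B c p)) - (?N' (B c p) / (2 * ?n * sqrt ?n)) * (v \<bullet> \<eta> c p) -
      ((1 / sqrt ?n) * (B c p \<bullet> ?\<eta>' v) - (?N' v / (2 * ?n * sqrt ?n)) * ?n)"
    unfolding D inner_diff_right inner_scaleR_right by (simp only: sq_norm_def)
  also have "\<dots> = (1 / sqrt ?n) * (v \<bullet> ?\<eta>' (B c p) - B c p \<bullet> ?\<eta>' v + 1/2 * ?N' v -
      stretch c p * (v \<bullet> \<eta> c p))"
  proof -
    have "1 / s * a - P / (2 * ?n * s) * w - (1 / s * a' - Q / (2 * ?n * s) * ?n) =
        1 / s * (a - a' + 1/2 * Q - P / (2 * ?n) * w)" if "s \<noteq> 0" for s a a' P Q w :: real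
      using n that by (simp add: field_simps)
    then show ?thesis unfolding stretch_def using n by simp
  qed
  finally show ?thesis
    by (simp add: cov_deriv_flux[OF c p] lower_def inner_diff_right matrix_vector_mult_diff_distrib
        matrix_vector_mult_scaleR)
qed

lemma contracted_curl_zero_unit_covector:
  assumes c: "c \<in> A" and p: "p \<in> fst c"
  shows "contracted_curl_zero B unit_covector c p \<longleftrightarrow>
    cov_deriv g B B c p = stretch c p *\<^sub>R B c p"
proof
  assume "contracted_curl_zero B unit_covector c p"
  then have "v \<bullet> (g c p *v (cov_deriv g B B c p - stretch c p *\<^sub>R B c p)) = 0" for v
    using curl_unit_covector[OF c p, of v] N_pos[OF c p] by (simp add: contracted_curl_zero_def)
  then show "cov_deriv g B B c p = stretch c p *\<^sub>R B c p"
    using positive_definite.positive[OF positive_definite[OF c p]]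
    by (metis less_irrefl right_minus_eq)
next
  assume "cov_deriv g B B c p = stretch c p *\<^sub>R B c p"
  then show "contracted_curl_zero B unit_covector c p"
    using curl_unit_covector[OF c p] by (simp add: contracted_curl_zero_def)
qed

lemma stretch_invariant:
  assumes "c \<in> A" "d \<in> A" "p \<in> fst c \<inter> fst d"
  shows "stretch c p = stretch d p"
  using D_scalar_transform[where f = N, OF assms N_invariant[OF assms(1,2)] smooth_N[OF assms(2)]]
    N_invariant[OF assms] B_transform[OF assms]
  by (simp add: stretch_def)

lemma smooth_stretch:
  assumes c: "c \<in> A"
  shows "smooth_on (snd c ` fst c) (loc stretch c)"
proof (rule smooth_on_cong_loc[OF c])
  have "2 * loc N c x \<noteq> 0" if x: "x \<in> snd c ` fst c" for x
  proof -
    obtain p where "p \<in> fst c" "x = snd c p" using x by blast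
    then show ?thesis using N_pos[OF c, of p] loc_eq[OF c, of p N] by simp
  qed
  then have "smooth_on (snd c ` fst c) (\<lambda>x. inverse (2 * loc N c x))"
    by (intro smooth_on_inverse smooth_on_mult smooth_on_const smooth_N c)
  then show "smooth_on (snd c ` fst c) (\<lambda>x. D (loc N c) x (loc B c x) * inverse (2 * loc N c x))"
    by (rule smooth_on_mult[OF smooth_on_D_field[OF openin_image[OF c] smooth_N[OF c] smooth_B[OF c]]])
  show "stretch c p = D (loc N c) (snd c p) (loc B c (snd c p)) * inverse (2 * loc N c (snd c p))"
    if "p \<in> fst c" for p
    unfolding loc_eq[OF c that] stretch_def divide_inverse ..
qed

text \<open>
  The equation in each chart yields the geodesic condition with the factor \<open>stretch\<close>; smoothness and
  chart independence of \<open>stretch\<close> make it a smooth function on the manifold.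
\<close>

lemma geodesic_iff:
  "geodesic A g \<beta> \<longleftrightarrow> (\<forall>c\<in>A. \<forall>p\<in>fst c. contracted_curl_zero B unit_covector c p)"
proof
  assume "geodesic A g \<beta>"
  then obtain \<rho> where \<rho>: "\<forall>c\<in>A. \<forall>p\<in>fst c. cov_deriv g B B c p = \<rho> p *\<^sub>R B c p"
    unfolding geodesic_def by blast
  show "\<forall>c\<in>A. \<forall>p\<in>fst c. contracted_curl_zero B unit_covector c p"
  proof (intro ballI)
    fix c p assume c: "c \<in> A" and p: "p \<in> fst c"
    have "cov_deriv g B B c p = \<rho> p *\<^sub>R B c p" using \<rho> c p by blast
    moreover from this have "\<rho> p = stretch c p" by (rule geodesic_factor[OF c p])
    ultimately show "contracted_curl_zero B unit_covector c p"
      unfolding contracted_curl_zero_unit_covector[OF c p] by simp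
  qed
next
  assume *: "\<forall>c\<in>A. \<forall>p\<in>fst c. contracted_curl_zero B unit_covector c p"
  have "smooth_function A (patch stretch)"
    using stretch_invariant smooth_stretch by (rule smooth_function_patch)
  moreover have "patch stretch p = stretch c p" if "c \<in> A" "p \<in> fst c" for c p
    using stretch_invariant that by (rule patch_eq)
  moreover have "cov_deriv g B B c p = stretch c p *\<^sub>R B c p" if "c \<in> A" "p \<in> fst c" for c p
    using * contracted_curl_zero_unit_covector[OF that] that by blast
  ultimately show "geodesic A g \<beta>"
    unfolding geodesic_def by (intro exI[of _ "patch stretch"]) simp
qed

lemma smooth_function_iff:
  "smooth_function A f \<longleftrightarrow> (\<forall>c\<in>A. smooth_on (snd c ` fst c) (\<lambda>x. f (chart_inv c x)))"
  by (simp add: smooth_function_def comp_def)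

lemma smooth_scaled:
  fixes \<alpha> :: "('a, 'n, 'n rvec) field"
  assumes "smooth_function A f" "c \<in> A" "smooth_on (snd c ` fst c) (loc \<alpha> c)"
  shows "smooth_on (snd c ` fst c) (loc (\<lambda>c p. f p *\<^sub>R \<alpha> c p) c)"
  using assms smooth_on_scaleR unfolding smooth_function_iff loc_def comp_def by blast

lemma smooth_function_exp:
  assumes "smooth_function A u"
  shows "smooth_function A (\<lambda>p. exp (k * u p))"
  using assms unfolding smooth_function_iff
  by (intro ballI smooth_on_exp smooth_on_mult smooth_on_const) blast

lemma smooth_function_combination:
  assumes "smooth_function A u" "smooth_function A v"
  shows "smooth_function A (\<lambda>p. k * u p + l * v p)"
  using assms unfolding smooth_function_iff
  by (intro ballI smooth_on_add smooth_on_mult smooth_on_const) blast+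

section \<open>Conformal change of the metric\<close>

lemma riemannian_flux_conformal:
  assumes "h \<in> conformal_class A g"
  shows "riemannian_flux X A h \<beta>"
  using assms form nonzero oriented_atlas_axioms
  by (simp add: riemannian_flux_def riemannian_flux_axioms_def conformal_class_def)

lemma conformal_class_intro:
  assumes u: "smooth_function A u"
  shows "(\<lambda>c p. exp (2 * u p) *\<^sub>R g c p) \<in> conformal_class A g"
proof -
  let ?h = "\<lambda>c p. exp (2 * u p) *\<^sub>R g c p"
  have "smooth_on (snd c ` fst c) (loc ?h c)" if c: "c \<in> A" for c
    using smooth_function_exp[OF u] c smooth_g[OF c] smooth_on_scaleR
    unfolding smooth_function_iff loc_def comp_def by blast
  moreover have "transpose (?h c p) = ?h c p \<and> (\<forall>v. v \<noteq> 0 \<longrightarrow> v \<bullet> (?h c p *v v) > 0)"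
    if "c \<in> A" "p \<in> fst c" for c p
  proof -
    have "transpose (r *\<^sub>R G) = r *\<^sub>R transpose G" for r and G :: "'n rmat"
      by (simp add: transpose_def vec_eq_iff)
    then show ?thesis
      using positive_definite[OF that]
      by (simp add: positive_definite_def flip: scaleR_matrix_vector_assoc)
  qed
  moreover have "v \<bullet> (?h c p *v w) = jac c d p v \<bullet> (?h d p *v jac c d p w)"
    if "c \<in> A" "d \<in> A" "p \<in> fst c \<inter> fst d" for c d p v w
  proof -
    have "v \<bullet> (g c p *v w) = jac c d p v \<bullet> (g d p *v jac c d p w)"
      using metric that unfolding riemannian_metric_def by blast
    then show ?thesis by (simp flip: scaleR_matrix_vector_assoc)
  qed
  ultimately have "riemannian_metric A ?h" unfolding riemannian_metric_def by blast
  then show ?thesis using u unfolding conformal_class_def by blast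
qed

text \<open>
  The matrix of the metric is scaled by \<open>exp(2u)\<close>, its determinant by \<open>exp(2nu)\<close>, hence the volume form
  by \<open>exp(nu)\<close> and \<open>B\<close> by the inverse factor.
\<close>

lemma conformal_quantities:
  assumes h: "h c p = exp (2 * u) *\<^sub>R g c p" and c: "c \<in> A" and p: "p \<in> fst c"
  shows "flux_field h \<beta> c p = exp (- (real CARD('n) * u)) *\<^sub>R B c p"
    and "lower h (flux_field h \<beta>) c p = exp ((2 - real CARD('n)) * u) *\<^sub>R \<eta> c p"
    and "sq_norm h (flux_field h \<beta>) c p = exp ((2 - 2 * real CARD('n)) * u) * N c p"
proof -
  have "r *\<^sub>R G = (\<chi> i. r *s G $ i)" for r and G :: "'n rmat"
    by (simp add: vec_eq_iff)
  then have "det (r *\<^sub>R G) = r ^ CARD('n) * det G" for r and G :: "'n rmat"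
    using det_rows_mul[of "\<lambda>_. r" "\<lambda>i. G $ i"] by simp
  then have "sqrt (det (h c p)) = sqrt (exp (2 * u) ^ CARD('n)) * sqrt (det (g c p))"
    by (simp add: h real_sqrt_mult)
  moreover have "exp (2 * u) ^ CARD('n) = (exp (real CARD('n) * u))\<^sup>2"
    by (simp add: exp_of_nat_mult[symmetric] exp_double[symmetric] mult_ac)
  ultimately have det: "sqrt (det (h c p)) = exp (real CARD('n) * u) * sqrt (det (g c p))"
    by simp
  then have "det (h c p) > 0" using det_pos[OF c p]
    by (metis exp_gt_zero mult_pos_pos real_sqrt_gt_0_iff)
  then show B: "flux_field h \<beta> c p = exp (- (real CARD('n) * u)) *\<^sub>R B c p"
    using flux_field_eq[where g = h and c = c and p = p and \<beta> = \<beta>, OF _ alternating[OF c p]]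
      flux_field_eq[where g = g and c = c and p = p and \<beta> = \<beta>, OF det_pos[OF c p] alternating[OF c p]]
    by (simp add: det exp_minus field_simps)
  have "exp (- (real CARD('n) * u)) * exp (2 * u) = exp ((2 - real CARD('n)) * u)"
    by (simp add: exp_add[symmetric] algebra_simps)
  then show \<eta>: "lower h (flux_field h \<beta>) c p = exp ((2 - real CARD('n)) * u) *\<^sub>R \<eta> c p"
    by (simp add: lower_def B h matrix_vector_mult_scaleR flip: scaleR_matrix_vector_assoc)
  have "exp ((2 - real CARD('n)) * u) * exp (- (real CARD('n) * u)) =
      exp ((2 - 2 * real CARD('n)) * u)"
    by (simp add: exp_add[symmetric] algebra_simps)
  then show "sq_norm h (flux_field h \<beta>) c p = exp ((2 - 2 * real CARD('n)) * u) * N c p"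
    by (simp add: sq_norm_def B \<eta> mult.assoc[symmetric])
qed

lemma force_free_conformal_iff:
  assumes "h \<in> conformal_class A g"
    and u: "smooth_function A u" "\<And>c p. c \<in> A \<Longrightarrow> p \<in> fst c \<Longrightarrow> h c p = exp (2 * u p) *\<^sub>R g c p"
  shows "force_free A h \<beta> \<longleftrightarrow> (\<forall>c\<in>A. \<forall>p\<in>fst c.
    contracted_curl_zero B (\<lambda>c p. exp ((2 - real CARD('n)) * u p) *\<^sub>R \<eta> c p) c p)"
proof -
  interpret h: riemannian_flux X A h \<beta> by (rule riemannian_flux_conformal[OF assms(1)])
  have "contracted_curl_zero B (\<lambda>c p. exp ((2 - real CARD('n)) * u p) *\<^sub>R \<eta> c p) c p \<longleftrightarrow>
      contracted_curl_zero h.B h.\<eta> c p" if "c \<in> A" "p \<in> fst c" for c p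
  proof (rule contracted_curl_zero_cong[OF that])
    show "exp ((2 - real CARD('n)) * u q) *\<^sub>R \<eta> c q = h.\<eta> c q" if q: "q \<in> fst c" for q
      using conformal_quantities(2)[where h = h and c = c and p = q, OF u(2)[OF \<open>c \<in> A\<close> q]]
        \<open>c \<in> A\<close> q by simp
    show "smooth_on (snd c ` fst c) (loc (\<lambda>c p. exp ((2 - real CARD('n)) * u p) *\<^sub>R \<eta> c p) c)"
      using that(1) by (intro smooth_scaled smooth_function_exp u(1) smooth_\<eta>)
    show "h.B c p = exp (- (real CARD('n) * u p)) *\<^sub>R B c p"
      by (rule conformal_quantities(1)[where h = h and c = c and p = p, OF u(2)[OF that] that])
  qed simp
  then show ?thesis using h.force_free_iff by simp
qed

text \<open>
  The unit covector of \<open>h\<close> is \<open>exp((2-n) u) / exp((1-n) u) = exp(u)\<close> times the one of \<open>g\<close>.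
\<close>

lemma geodesic_conformal_iff:
  assumes "h \<in> conformal_class A g"
    and u: "smooth_function A u" "\<And>c p. c \<in> A \<Longrightarrow> p \<in> fst c \<Longrightarrow> h c p = exp (2 * u p) *\<^sub>R g c p"
  shows "geodesic A h \<beta> \<longleftrightarrow> (\<forall>c\<in>A. \<forall>p\<in>fst c.
    contracted_curl_zero B (\<lambda>c p. exp (u p) *\<^sub>R unit_covector c p) c p)"
proof -
  interpret h: riemannian_flux X A h \<beta> by (rule riemannian_flux_conformal[OF assms(1)])
  have "contracted_curl_zero B (\<lambda>c p. exp (u p) *\<^sub>R unit_covector c p) c p \<longleftrightarrow>
      contracted_curl_zero h.B h.unit_covector c p" if c: "c \<in> A" and p: "p \<in> fst c" for c p
  proof (rule contracted_curl_zero_cong[OF c p])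
    fix q assume q: "q \<in> fst c"
    note [simp] = conformal_quantities(2,3)[where h = h and c = c and p = q, OF u(2)[OF c q] c q]
    let ?n = "real CARD('n)"
    have "exp ((2 - 2 * ?n) * u q) = (exp ((1 - ?n) * u q))\<^sup>2"
      by (simp add: exp_double[symmetric] algebra_simps)
    then have "sqrt (exp ((2 - 2 * ?n) * u q) * N c q) = exp ((1 - ?n) * u q) * sqrt (N c q)"
      by (simp add: real_sqrt_mult)
    moreover have "exp ((2 - ?n) * u q) = exp (u q) * exp ((1 - ?n) * u q)"
      by (simp add: exp_add[symmetric] algebra_simps)
    ultimately show "exp (u q) *\<^sub>R unit_covector c q = h.unit_covector c q"
      by simp
  next
    show "smooth_on (snd c ` fst c) (loc (\<lambda>c p. exp (u p) *\<^sub>R unit_covector c p) c)"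
      using smooth_scaled[OF smooth_function_exp[OF u(1), of 1] c smooth_unit_covector[OF c]] by simp
    show "h.B c p = exp (- (real CARD('n) * u p)) *\<^sub>R B c p"
      by (rule conformal_quantities(1)[where h = h and c = c and p = p, OF u(2)[OF c p] c p])
  qed simp
  then show ?thesis using h.geodesic_iff by simp
qed

text \<open>
  The relation between \<open>u\<close> and \<open>v\<close> is exactly \<open>exp((2-n) v) \<eta> = exp(u) \<eta>/\<surd>N\<close>, so the same 1-form
  occurs in both conditions.
\<close>

lemma force_free_iff_geodesic:
  assumes h: "h \<in> conformal_class A g" "smooth_function A v"
      "\<And>c p. c \<in> A \<Longrightarrow> p \<in> fst c \<Longrightarrow> h c p = exp (2 * v p) *\<^sub>R g c p"
    and h': "h' \<in> conformal_class A g" "smooth_function A u"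
      "\<And>c p. c \<in> A \<Longrightarrow> p \<in> fst c \<Longrightarrow> h' c p = exp (2 * u p) *\<^sub>R g c p"
    and uv: "\<And>c p. c \<in> A \<Longrightarrow> p \<in> fst c \<Longrightarrow> u p = (2 - real CARD('n)) * v p + ln (N c p) / 2"
  shows "force_free A h \<beta> \<longleftrightarrow> geodesic A h' \<beta>"
proof -
  have "contracted_curl_zero B (\<lambda>c p. exp ((2 - real CARD('n)) * v p) *\<^sub>R \<eta> c p) c p \<longleftrightarrow>
      contracted_curl_zero B (\<lambda>c p. exp (u p) *\<^sub>R unit_covector c p) c p"
    if c: "c \<in> A" and p: "p \<in> fst c" for c p
  proof (rule contracted_curl_zero_cong[OF c p, where r = 1])
    fix q assume q: "q \<in> fst c"
    have "exp (ln (N c q) / 2) = sqrt (N c q)"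
      using N_pos[OF c q] by (simp add: ln_sqrt[symmetric])
    then have "exp (u q) = exp ((2 - real CARD('n)) * v q) * sqrt (N c q)"
      using uv[OF c q] by (simp add: exp_add)
    then show "exp ((2 - real CARD('n)) * v q) *\<^sub>R \<eta> c q = exp (u q) *\<^sub>R unit_covector c q"
      using N_pos[OF c q] by simp
  next
    show "smooth_on (snd c ` fst c) (loc (\<lambda>c p. exp ((2 - real CARD('n)) * v p) *\<^sub>R \<eta> c p) c)"
      by (rule smooth_scaled[OF smooth_function_exp[OF h(2)] c smooth_\<eta>[OF c]])
  qed simp_all
  then show ?thesis
    using force_free_conformal_iff[OF h] geodesic_conformal_iff[OF h'] by simp
qed

definition log_norm :: "'a \<Rightarrow> real" where
  "log_norm = patch (\<lambda>c p. ln (N c p) / 2)"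

lemma log_norm_eq: "c \<in> A \<Longrightarrow> p \<in> fst c \<Longrightarrow> log_norm p = ln (N c p) / 2"
  unfolding log_norm_def by (rule patch_eq) (metis N_invariant)+

lemma smooth_log_norm: "smooth_function A log_norm"
  unfolding log_norm_def
proof (rule smooth_function_patch)
  show "ln (N c p) / 2 = ln (N d p) / 2" if "c \<in> A" "d \<in> A" "p \<in> fst c \<inter> fst d" for c d p
    using N_invariant[OF that] by simp
  show "smooth_on (snd c ` fst c) (loc (\<lambda>c p. ln (N c p) / 2) c)" if c: "c \<in> A" for c
  proof (rule smooth_on_cong_loc[OF c])
    show "smooth_on (snd c ` fst c) (\<lambda>x. ln (loc N c x) * (1/2))"
      using N_pos[OF c]
      by (intro smooth_on_mult smooth_on_ln smooth_on_const smooth_N c) (auto simp: loc_eq c)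
  qed (use c in \<open>simp add: loc_eq\<close>)
qed

text \<open>
  Solve \<open>u = (2-n) v + ln N / 2\<close> for \<open>u\<close> in one direction and, dividing by \<open>2 - n\<close>, for \<open>v\<close> in the
  other.
\<close>

lemma conformal_force_free_iff_geodesic:
  assumes dim: "CARD('n) \<ge> 3"
  shows "(\<exists>h\<in>conformal_class A g. force_free A h \<beta>) \<longleftrightarrow>
    (\<exists>h\<in>conformal_class A g. geodesic A h \<beta>)"
proof
  assume "\<exists>h\<in>conformal_class A g. force_free A h \<beta>"
  then obtain h v where h: "h \<in> conformal_class A g" "smooth_function A v"
      "\<And>c p. c \<in> A \<Longrightarrow> p \<in> fst c \<Longrightarrow> h c p = exp (2 * v p) *\<^sub>R g c p" and "force_free A h \<beta>"
    unfolding conformal_class_def by blast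
  define u where "u p = (2 - real CARD('n)) * v p + 1 * log_norm p" for p
  have u: "smooth_function A u"
    unfolding u_def by (intro smooth_function_combination h(2) smooth_log_norm)
  have "geodesic A (\<lambda>c p. exp (2 * u p) *\<^sub>R g c p) \<beta>"
    using \<open>force_free A h \<beta>\<close>
    by (subst force_free_iff_geodesic[OF h conformal_class_intro[OF u] u, symmetric])
      (simp_all add: u_def log_norm_eq)
  then show "\<exists>h\<in>conformal_class A g. geodesic A h \<beta>" using conformal_class_intro[OF u] by blast
next
  assume "\<exists>h\<in>conformal_class A g. geodesic A h \<beta>"
  then obtain h u where h: "h \<in> conformal_class A g" "smooth_function A u"
      "\<And>c p. c \<in> A \<Longrightarrow> p \<in> fst c \<Longrightarrow> h c p = exp (2 * u p) *\<^sub>R g c p" and "geodesic A h \<beta>"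
    unfolding conformal_class_def by blast
  define k where "k = 1 / (2 - real CARD('n))"
  have k: "(2 - real CARD('n)) * k = 1" using dim by (simp add: k_def)
  define v where "v p = k * u p + (- k) * log_norm p" for p
  have v: "smooth_function A v"
    unfolding v_def by (intro smooth_function_combination h(2) smooth_log_norm)
  have "(2 - real CARD('n)) * v p = ((2 - real CARD('n)) * k) * (u p - log_norm p)" for p
    by (simp add: v_def algebra_simps)
  then have "u p = (2 - real CARD('n)) * v p + log_norm p" for p by (simp add: k)
  then have "force_free A (\<lambda>c p. exp (2 * v p) *\<^sub>R g c p) \<beta>"
    using \<open>geodesic A h \<beta>\<close> log_norm_eq
    by (subst force_free_iff_geodesic[OF conformal_class_intro[OF v] v _ h]) auto
  then show "\<exists>h\<in>conformal_class A g. force_free A h \<beta>" using conformal_class_intro[OF v] by blast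
qed

end

theorem theorem1p2:
  fixes X :: "'a topology"
    and A :: "('a, 'n::{finite,linorder}) chart set"
    and g :: "('a, 'n, 'n rmat) field"
    and \<beta> :: "('a, 'n) form"
  assumes "CARD('n) \<ge> 3"
    and "oriented_manifold X A"
    and "riemannian_metric A g"
    and "differential_form A (CARD('n) - 1) \<beta>"
    and "closed_form A (CARD('n) - 1) \<beta>"
    and "nowhere_vanishing A (CARD('n) - 1) \<beta>"
  shows "(\<exists>h\<in>conformal_class A g. force_free A h \<beta>) \<longleftrightarrow>
         (\<exists>h\<in>conformal_class A g. geodesic A h \<beta>)"
proof -
  interpret riemannian_flux X A g \<beta>
    using assms by unfold_locales
  show ?thesis by (rule conformal_force_free_iff_geodesic[OF assms(1)])
qed

end
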